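(* Let $v>0$ be a real number. Then the following four identities hold. (1) $$\mathrm{m}\left(1-v^4\left(\frac{1-x}{1+x}\right)^2+\left(y+v^2\left(\frac{1-x}{1+x}\right)\right)^2z\right)=\frac4\pi\int_0^v\frac{\tan^{-1}(u)}{u}\,du-\frac{8}{\pi^2}\mathrm{T}\left(v,\frac1v\right)+\frac12\mathrm{m}\left(1-v^4\left(\frac{1-x}{1+x}\right)^2\right).$$ (2) $$\mathrm{m}\left(1-v^4\left(\frac{1-x}{1+x}\right)^2+v^2\left(\frac{1-x}{1+x}\right)\left(\frac{1-y}{1+y}\right)(z-z^{-1})\right)=\frac8\pi\int_0^v\frac{\tan^{-1}(u)}{u}\,du-\frac{16}{\pi^2}\mathrm{T}\left(v,\frac1v\right).$$ (3) $$\mathrm{m}\left((y-y^{-1})+v^2\left(\frac{1-x}{1+x}\right)(z-z^{-1})\right)=\frac4\pi\int_0^v\frac{\tan^{-1}(u)}{u}\,du-\frac{8}{\pi^2}\mathrm{T}\left(v,\frac1v\right).$$ (4) $$\mathrm{m}\left(\left(4(1+y)^2-(z+z^{-1})^2\right)\left(1-v^4\left(\frac{1-x}{1+x}\right)^2\right)^2+(z-z^{-1})^2(1+y)^2\left(1+v^4\left(\frac{1-x}{1+x}\right)^2\right)^2\right)$$ $$=\frac8\pi\int_0^v\frac{\tan^{-1}(u)}{u}\,du-\frac{16}{\pi^2}\mathrm{T}\left(v,\frac1v\right)+\frac4\pi\int_0^{\pi/2}\log\left(1+v^2\tan(\theta)\right)d\theta+\log(2).$$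
   Context: For a nonzero rational function $P$ in $n$ variables, its (logarithmic) Mahler measure is $\mathrm{m}(P)=\int_0^1\cdots\int_0^1\log|P(e^{2\pi i\theta_1},\dots,e^{2\pi i\theta_n})|\,d\theta_1\cdots d\theta_n$, the integration being over all variables $x,y,z$ that occur. The function $\mathrm{T}$ is $\mathrm{T}(v,w)=\int_0^1\frac{\tan^{-1}(vx)\tan^{-1}(wx)}{x}\,dx$. *)

theory Defs
  imports "HOL-Analysis.Analysis"
begin

text \<open>
  An \<open>n\<close>-variable rational function is given by its evaluation \<open>P\<close> on points
  \<open>w :: nat \<Rightarrow> complex\<close>, reading only the coordinates \<open>w 0, \<dots>, w (n - 1)\<close>.
  Zeros and poles of a nonzero rational function meet the torus in a null set, so the
  conventions \<open>ln 0 = 0\<close> and \<open>z / 0 = 0\<close> do not affect the integral.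
\<close>

definition mahler_measure :: "nat \<Rightarrow> ((nat \<Rightarrow> complex) \<Rightarrow> complex) \<Rightarrow> real" where
  "mahler_measure n P =
     (LINT \<theta> | (\<Pi>\<^sub>M i\<in>{..<n}. restrict_space lborel {0..1}).
        ln (cmod (P (\<lambda>i. exp (2 * of_real pi * \<i> * of_real (\<theta> i))))))"

definition mahler1 :: "(complex \<Rightarrow> complex) \<Rightarrow> real" where
  "mahler1 P = mahler_measure 1 (\<lambda>w. P (w 0))"

definition mahler3 :: "(complex \<Rightarrow> complex \<Rightarrow> complex \<Rightarrow> complex) \<Rightarrow> real" where
  "mahler3 P = mahler_measure 3 (\<lambda>w. P (w 0) (w 1) (w 2))"

definition T_arctan :: "real \<Rightarrow> real \<Rightarrow> real" where
  "T_arctan v w = (LBINT x:{0..1}. arctan (v * x) * arctan (w * x) / x)"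

end

theory Submission
  imports Defs "HOL-Probability.Probability" "HOL-Complex_Analysis.Complex_Analysis"
begin

text \<open>
  On the torus \<open>(1 - x) / (1 + x) = - \<i> tan (\<pi> \<theta>)\<close>, so each polynomial depends on \<open>x\<close> only through
  \<open>s = v\<^sup>2 tan (\<pi> \<theta>)\<close>, whose absolute value follows a half-Cauchy law of scale \<open>v\<^sup>2\<close>. For fixed \<open>s\<close>,
  Jensen's formula evaluates one of the two remaining integrals, and the other one turns into
  a combination of elementary logarithms and the inverse tangent integral \<open>Ti\<^sub>2 \<bar>s\<bar>\<close>. Finally, the
  half-Cauchy mean of \<open>Ti\<^sub>2\<close> is \<open>(2 / \<pi>) \<integral>\<^sub>0\<^sup>\<infinity> arctan u arctan (v\<^sup>2 / u) / u du\<close>, which the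
  inversion \<open>u \<mapsto> v\<^sup>2 / u\<close> folds onto \<open>[0, v]\<close>.
\<close>

text \<open>The obstacle is Fubini: the integrands are logarithms, singular at the zeros of the
  polynomials and, through \<open>tan\<close>, at x = -1, so absolute integrability on the cube is
  not visible in advance. It is derived from the iterated integrals themselves: an upper bound by an
  integrable function of x alone controls the negative part once the successive means are known to
  be integrable. For identity (2) no such bound exists, but its integrand is nonnegative and the
  argument is run for the negative. In the three-variable integrals, parameters that would put a
  root on the unit circle are discarded, since they lie over countable sets of angles. Ti_2(s)
  enters through two means over an angle b: that of arsinh(s |sin b|) is (2/pi) Ti_2(s), that of
  ln(1 + s^2 + 2 s |sin b|) is (4/pi) Ti_2(s). In both, differentiation in s leaves a kernel whose
  integral over b is elementary. Identity (3) uses the first, (1) and (2) the second, and (4)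
  reaches the second by exchanging the order of an auxiliary double integral.\<close>

section \<open>The uniform probability measure on the unit interval\<close>

definition unit_measure :: "real measure" where
  "unit_measure = restrict_space lborel {0..1}"

lemma space_unit_measure [simp]: "space unit_measure = {0..1}"
  by (simp add: unit_measure_def space_restrict_space)

lemma prob_space_unit_measure: "prob_space unit_measure"
  by (rule prob_spaceI) (simp add: unit_measure_def emeasure_restrict_space space_restrict_space)

interpretation unit: prob_space unit_measure
  by (rule prob_space_unit_measure)

lemma measurable_unit_measure:
  "f \<in> measurable borel M \<Longrightarrow> f \<in> measurable unit_measure M"
  by (simp add: unit_measure_def measurable_restrict_space1)

lemma integral_unit_measure:
  fixes f :: "real \<Rightarrow> real"
  shows "integral\<^sup>L unit_measure f = (LBINT x:{0..1}. f x)"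
  by (simp add: unit_measure_def set_lebesgue_integral_def integral_restrict_space)

lemma integrable_unit_measure:
  fixes f :: "real \<Rightarrow> real"
  shows "integrable unit_measure f \<longleftrightarrow> set_integrable lborel {0..1} f"
  by (simp add: unit_measure_def set_integrable_def integrable_restrict_space)

lemma AE_unit_measure_countable:
  assumes "countable {x. \<not> P x}"
  shows "AE x in unit_measure. P x"
proof -
  have "AE x in lborel. x \<notin> {x. \<not> P x}"
    by (rule AE_not_in) (rule countable_imp_null_set_lborel[OF assms])
  then have "AE x in lborel. x \<in> {0..1} \<longrightarrow> P x"
    by eventually_elim auto
  then show ?thesis
    unfolding unit_measure_def by (subst AE_restrict_space_iff) auto
qed

text \<open>Cauchy's formula and the fundamental theorem of calculus deliver gauge integrals;
  continuity on the compact interval turns them into Bochner integrals of the same value.\<close>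

lemma unit_measure_continuous:
  fixes f :: "real \<Rightarrow> real"
  assumes "continuous_on {0..1} f" and "(f has_integral I) {0..1}"
  shows "integrable unit_measure f \<and> integral\<^sup>L unit_measure f = I"
proof -
  have 1: "set_integrable lborel {0..1} f"
    by (rule borel_integrable_compact[OF _ assms(1), simplified set_integrable_def[symmetric]])
       auto
  show ?thesis
    using 1 set_borel_integral_eq_integral(2)[OF 1] integral_unique[OF assms(2)]
    by (simp add: integrable_unit_measure integral_unit_measure)
qed

lemma integral_unit_measure_reflect:
  fixes f :: "real \<Rightarrow> real"
  shows "(LINT x|unit_measure. f (1 - x)) = (LINT x|unit_measure. f x)"
proof -
  have "(LINT x|unit_measure. f x) = (LINT x|lborel. indicator {0..1} x *\<^sub>R f x)"
    by (simp add: integral_unit_measure set_lebesgue_integral_def)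
  also have "\<dots> = (LINT x|lborel. indicator {0..1} (1 + (-1) * x) *\<^sub>R f (1 + (-1) * x))"
    by (subst lborel_integral_real_affine[where c = "-1" and t = 1]) auto
  also have "(\<lambda>x::real. indicator {0..1} (1 + (-1) * x)) = (indicator {0..1} :: real \<Rightarrow> real)"
    by (auto simp: indicator_def)
  finally show ?thesis
    by (simp add: integral_unit_measure set_lebesgue_integral_def)
qed

subsection \<open>Jensen's formula\<close>

definition unit_circle :: "real \<Rightarrow> complex" where
  "unit_circle \<theta> = exp (2 * of_real pi * \<i> * of_real \<theta>)"

lemma unit_circle_eq_cis: "unit_circle \<theta> = cis (2 * pi * \<theta>)"
  by (simp add: unit_circle_def cis_conv_exp mult_ac)

lemma norm_unit_circle [simp]: "cmod (unit_circle \<theta>) = 1"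
  by (simp add: unit_circle_eq_cis)

lemma unit_circle_nonzero [simp]: "unit_circle \<theta> \<noteq> 0"
  by (simp add: unit_circle_eq_cis)

lemma continuous_on_unit_circle [continuous_intros]: "continuous_on S unit_circle"
  unfolding unit_circle_def by (intro continuous_intros)

lemma measurable_unit_circle [measurable]: "unit_circle \<in> borel_measurable borel"
  by (intro borel_measurable_continuous_onI continuous_intros)

text \<open>With \<open>unit_circle\<close> as parametrisation, du / u = 2 pi i dtheta, so Cauchy's
  formula at the centre becomes the mean value property.\<close>

lemma holomorphic_mean_value:
  assumes "continuous_on (cball 0 1) f" "f holomorphic_on ball 0 1"
  shows "((\<lambda>\<theta>. f (unit_circle \<theta>)) has_integral f 0) {0..1}"
proof -
  have "((\<lambda>u. f u / (u - 0)) has_contour_integral (2 * of_real pi * \<i> * f 0)) (circlepath 0 1)"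
    by (rule Cauchy_integral_circlepath) (use assms in auto)
  then have "((\<lambda>x. 2 * of_real pi * \<i> * f (unit_circle x)) has_integral (2 * of_real pi * \<i> * f 0)) {0..1}"
    unfolding has_contour_integral vector_derivative_circlepath
    by (simp add: circlepath unit_circle_def field_simps)
  then have "((\<lambda>x. (1 / (2 * of_real pi * \<i>)) * (2 * of_real pi * \<i> * f (unit_circle x)))
      has_integral (1 / (2 * of_real pi * \<i>)) * (2 * of_real pi * \<i> * f 0)) {0..1}"
    by (rule has_integral_mult_right)
  then show ?thesis by simp
qed

text \<open>After factoring out \<open>a\<close>, the remaining 1 + c z^k satisfies |c z^k| < 1 on
  the closed disc, so it stays in the right half-plane, where the principal \<open>Ln\<close> is
  holomorphic. The mean is the value at the centre, which is 0 because \<open>0 < k\<close>.\<close>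

lemma jensen_linear_less:
  fixes a b :: complex
  assumes "cmod b < cmod a" "0 < k"
  shows "((\<lambda>\<theta>. ln (cmod (a + b * unit_circle \<theta> ^ k))) has_integral ln (cmod a)) {0..1}"
proof -
  define c where "c = b / a"
  have a: "a \<noteq> 0" using assms by auto
  have c: "cmod c < 1" using assms a by (simp add: c_def norm_divide)
  have lt: "cmod (c * z ^ k) < 1" if "cmod z \<le> 1" for z
  proof -
    have "cmod (c * z ^ k) \<le> cmod c * 1"
      unfolding norm_mult norm_power by (intro mult_left_mono power_le_one that) auto
    then show ?thesis using c by simp
  qed
  have nz: "1 + c * z ^ k \<notin> \<real>\<^sub>\<le>\<^sub>0" if "cmod z \<le> 1" for z
  proof
    assume "1 + c * z ^ k \<in> \<real>\<^sub>\<le>\<^sub>0"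
    then have "Re (1 + c * z ^ k) \<le> 0" by (auto simp: complex_nonpos_Reals_iff)
    moreover have "\<bar>Re (c * z ^ k)\<bar> < 1" using lt[OF that] abs_Re_le_cmod[of "c * z ^ k"] by linarith
    ultimately show False by simp
  qed
  have "((\<lambda>\<theta>. Ln (1 + c * unit_circle \<theta> ^ k)) has_integral Ln (1 + c * 0 ^ k)) {0..1}"
    by (rule holomorphic_mean_value) (use nz in \<open>auto intro!: continuous_intros holomorphic_intros\<close>)
  then have "((\<lambda>\<theta>. Re (Ln (1 + c * unit_circle \<theta> ^ k))) has_integral Re (Ln (1 + c * 0 ^ k))) {0..1}"
    by (rule has_integral_Re)
  then have "((\<lambda>\<theta>. Re (Ln (1 + c * unit_circle \<theta> ^ k))) has_integral 0) {0..1}"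
    using assms by (simp add: zero_power)
  then have "((\<lambda>\<theta>. ln (cmod a) + Re (Ln (1 + c * unit_circle \<theta> ^ k))) has_integral
      (ln (cmod a) + 0)) {0..1}"
    by (intro has_integral_add) (use has_integral_const_real[of "ln (cmod a)" 0 1] in auto)
  moreover have "ln (cmod a) + Re (Ln (1 + c * unit_circle \<theta> ^ k)) = ln (cmod (a + b * unit_circle \<theta> ^ k))" for \<theta>
  proof -
    have z: "1 + c * unit_circle \<theta> ^ k \<noteq> 0" using nz[of "unit_circle \<theta>"] by auto
    have "a + b * unit_circle \<theta> ^ k = a * (1 + c * unit_circle \<theta> ^ k)"
      using a by (simp add: c_def field_simps)
    then show ?thesis using z a by (simp add: norm_mult ln_mult)
  qed
  ultimately show ?thesis by simp
qed

text \<open>If \<open>b\<close> dominates, conjugation and a unit factor exchange the coefficients: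
  |a + b w| = |cnj b + cnj a * w| for |w| = 1. Equal moduli could put a zero on the circle and make
  the integrand unbounded; callers meet that case only on null sets.\<close>

lemma jensen_linear:
  fixes a b :: complex
  assumes "cmod a \<noteq> cmod b" "0 < k"
  shows "integrable unit_measure (\<lambda>\<theta>. ln (cmod (a + b * unit_circle \<theta> ^ k)))"
    and "(LINT \<theta>|unit_measure. ln (cmod (a + b * unit_circle \<theta> ^ k))) = ln (max (cmod a) (cmod b))"
proof -
  have nz: "a + b * unit_circle \<theta> ^ k \<noteq> 0" for \<theta>
  proof
    assume "a + b * unit_circle \<theta> ^ k = 0"
    then have "a = - (b * unit_circle \<theta> ^ k)" by (simp add: add_eq_0_iff2)
    then show False using assms(1) by (simp add: norm_mult norm_power)
  qed
  have "((\<lambda>\<theta>. ln (cmod (a + b * unit_circle \<theta> ^ k))) has_integral ln (max (cmod a) (cmod b))) {0..1}"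
  proof (cases "cmod b < cmod a")
    case True
    then show ?thesis using jensen_linear_less[OF True assms(2)] by simp
  next
    case False
    then have "cmod (cnj a) < cmod (cnj b)" using assms by simp
    moreover have "cmod (cnj b + cnj a * unit_circle \<theta> ^ k) = cmod (a + b * unit_circle \<theta> ^ k)" for \<theta>
    proof -
      have "cmod (cnj b + cnj a * unit_circle \<theta> ^ k) = cmod (cnj (cnj b + cnj a * unit_circle \<theta> ^ k))"
        by (simp only: complex_mod_cnj)
      also have "\<dots> = cmod (unit_circle \<theta> ^ k * (b + a * cnj (unit_circle \<theta> ^ k)))"
        by (simp add: norm_mult norm_power)
      also have "unit_circle \<theta> ^ k * (b + a * cnj (unit_circle \<theta> ^ k)) =
          b * unit_circle \<theta> ^ k + a * (unit_circle \<theta> ^ k * cnj (unit_circle \<theta> ^ k))"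
        by (simp add: algebra_simps)
      also have "unit_circle \<theta> ^ k * cnj (unit_circle \<theta> ^ k) = 1"
        using complex_norm_square[of "unit_circle \<theta> ^ k"] by (simp add: norm_power)
      finally show ?thesis by (simp add: add.commute)
    qed
    ultimately show ?thesis
      using jensen_linear_less[OF _ assms(2), of "cnj a" "cnj b"] False by (simp add: max_def)
  qed
  moreover have "continuous_on {0..1} (\<lambda>\<theta>. ln (cmod (a + b * unit_circle \<theta> ^ k)))"
    by (intro continuous_intros) (use nz in auto)
  ultimately show "integrable unit_measure (\<lambda>\<theta>. ln (cmod (a + b * unit_circle \<theta> ^ k)))"
    and "(LINT \<theta>|unit_measure. ln (cmod (a + b * unit_circle \<theta> ^ k))) = ln (max (cmod a) (cmod b))"
    using unit_measure_continuous by blast+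
qed

section \<open>Logarithmic means of trigonometric expressions\<close>

text \<open>A cos t + i B sin t = ((A - B) e^(-it) + (A + B) e^(it)) / 2; the unit factor e^(it)
  turns it into a linear polynomial in e^(2it) with dominant coefficient (A + B) / 2. The angle is
  \<open>k * pi * \<theta>\<close> because a Cayley transform produces the half angle
  (\<open>k = 1\<close>), whereas sines and cosines of a torus variable need
  \<open>k = 2\<close>.\<close>

lemma jensen_ellipse:
  fixes A B :: real
  assumes "A > 0" "B > 0" "0 < (k::nat)"
  shows "integrable unit_measure (\<lambda>\<theta>. ln (cmod (Complex (A * cos (k * pi * \<theta>)) (B * sin (k * pi * \<theta>)))))"
    and "(LINT \<theta>|unit_measure. ln (cmod (Complex (A * cos (k * pi * \<theta>)) (B * sin (k * pi * \<theta>))))) = ln ((A + B) / 2)"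
proof -
  have eq: "cmod (Complex (A * cos (k * pi * \<theta>)) (B * sin (k * pi * \<theta>))) =
      cmod (of_real ((A - B) / 2) + of_real ((A + B) / 2) * unit_circle \<theta> ^ k)" for \<theta>
  proof -
    have 1: "unit_circle \<theta> ^ k = cis (k * pi * \<theta>) * cis (k * pi * \<theta>)"
      by (simp add: unit_circle_eq_cis Complex.DeMoivre cis_mult algebra_simps)
    have 2: "cis (k * pi * \<theta>) * cis (- (k * pi * \<theta>)) = 1"
      by (simp add: cis_mult)
    have "of_real ((A - B) / 2) + of_real ((A + B) / 2) * unit_circle \<theta> ^ k =
      cis (k * pi * \<theta>) * (of_real ((A - B) / 2) * cis (- (k * pi * \<theta>)) + of_real ((A + B) / 2) * cis (k * pi * \<theta>))"
      unfolding 1 using 2 by (simp add: algebra_simps)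
    also have "of_real ((A - B) / 2) * cis (- (k * pi * \<theta>)) + of_real ((A + B) / 2) * cis (k * pi * \<theta>)
        = Complex (A * cos (k * pi * \<theta>)) (B * sin (k * pi * \<theta>))"
      by (simp add: complex_eq_iff field_simps)
    finally show ?thesis by (simp add: norm_mult)
  qed
  have ne: "cmod (of_real ((A - B) / 2)) \<noteq> cmod (of_real ((A + B) / 2))"
    using assms unfolding norm_of_real by (auto simp: abs_if field_simps)
  have m: "max (cmod (of_real ((A - B) / 2))) (cmod (of_real ((A + B) / 2))) = (A + B) / 2"
    using assms unfolding norm_of_real by (auto simp: abs_if field_simps max_def)
  show "integrable unit_measure (\<lambda>\<theta>. ln (cmod (Complex (A * cos (k * pi * \<theta>)) (B * sin (k * pi * \<theta>)))))"
    and "(LINT \<theta>|unit_measure. ln (cmod (Complex (A * cos (k * pi * \<theta>)) (B * sin (k * pi * \<theta>))))) = ln ((A + B) / 2)"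
    using jensen_linear[OF ne assms(3)] unfolding eq m by auto
qed

lemma countable_cos_zeros:
  fixes c :: real
  assumes "c \<noteq> 0"
  shows "countable {x. cos (c * x) = 0}"
proof (rule countable_subset)
  show "{x. cos (c * x) = 0} \<subseteq> range (\<lambda>i::int. of_int i * (pi / 2) / c)"
    using assms by (auto simp: cos_zero_iff_int field_simps image_iff)
qed auto

lemma countable_sin_zeros:
  fixes c :: real
  assumes "c \<noteq> 0"
  shows "countable {x. sin (c * x) = 0}"
proof (rule countable_subset)
  show "{x. sin (c * x) = 0} \<subseteq> range (\<lambda>i::int. of_int i * (pi / 2) / c)"
    using assms by (auto simp: sin_zero_iff_int field_simps image_iff)
qed auto

text \<open>The degenerate ellipse is reached by monotone convergence as the second axis shrinks.\<close>

lemma jensen_cos: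
  assumes "0 < (k::nat)"
  shows "integrable unit_measure (\<lambda>\<theta>. ln \<bar>cos (k * pi * \<theta>)\<bar>)"
    and "(LINT \<theta>|unit_measure. ln \<bar>cos (k * pi * \<theta>)\<bar>) = - ln 2"
proof -
  \<comment> \<open>The sign makes the sequence nonnegative and increasing as the second axis
    shrinks, as monotone convergence requires.\<close>
  define f where "f n \<theta> = - ln (cmod (Complex (1 * cos (k * pi * \<theta>)) ((1 / Suc n) * sin (k * pi * \<theta>))))" for n \<theta>
  have ae: "AE \<theta> in unit_measure. cos (k * pi * \<theta>) \<noteq> 0"
    using countable_cos_zeros[of "k * pi"] assms
    by (intro AE_unit_measure_countable) simp
  have 1: "integrable unit_measure (f n)" for n
    unfolding f_def using jensen_ellipse(1)[of 1 "1 / Suc n" k] assms by simp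
  have 2: "(\<lambda>n. integral\<^sup>L unit_measure (f n)) \<longlonglongrightarrow> ln 2"
  proof -
    have "(\<lambda>n. - ln ((1 + 1 / real (Suc n)) / 2)) \<longlonglongrightarrow> - ln ((1 + 0) / 2)"
      by (intro tendsto_intros) (use LIMSEQ_inverse_real_of_nat in \<open>auto simp: inverse_eq_divide\<close>)
    moreover have "integral\<^sup>L unit_measure (f n) = - ln ((1 + 1 / real (Suc n)) / 2)" for n
      unfolding f_def using jensen_ellipse(2)[of 1 "1 / Suc n" k] assms by simp
    ultimately show ?thesis by (simp add: ln_div)
  qed
  have sq: "(cos t)\<^sup>2 + (1 / Suc n * sin t)\<^sup>2 \<le> (cos t)\<^sup>2 + (1 / Suc m * sin t)\<^sup>2" if "m \<le> n" for m n t
    using that by (intro add_left_mono, unfold power_mult_distrib, intro mult_right_mono power_mono)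
      (auto simp: field_simps)
  \<comment> \<open>At index 0 the ellipse is the unit circle, so every modulus is at most
    1.\<close>
  have pos: "AE \<theta> in unit_measure. 0 \<le> f n \<theta>" for n
    using ae
  proof eventually_elim
    case (elim \<theta>)
    have "(cos (k * pi * \<theta>))\<^sup>2 + (1 / Suc n * sin (k * pi * \<theta>))\<^sup>2 \<le> 1"
      using sq[of 0 n "k * pi * \<theta>"] by simp
    moreover have "0 < (cos (k * pi * \<theta>))\<^sup>2 + (1 / Suc n * sin (k * pi * \<theta>))\<^sup>2"
      using elim by (intro add_pos_nonneg) auto
    ultimately show ?case
      unfolding f_def cmod_def by simp
  qed
  have mono: "AE \<theta> in unit_measure. mono (\<lambda>n. f n \<theta>)"
    using ae
  proof eventually_elim
    case (elim \<theta>)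
    have p: "0 < (cos (k * pi * \<theta>))\<^sup>2 + (1 / Suc n * sin (k * pi * \<theta>))\<^sup>2" for n
      using elim by (intro add_pos_nonneg) auto
    show ?case
    proof (rule monoI)
      fix m n :: nat assume "m \<le> n"
      then have "sqrt ((cos (k * pi * \<theta>))\<^sup>2 + (1 / Suc n * sin (k * pi * \<theta>))\<^sup>2)
          \<le> sqrt ((cos (k * pi * \<theta>))\<^sup>2 + (1 / Suc m * sin (k * pi * \<theta>))\<^sup>2)"
        using sq by simp
      then show "f m \<theta> \<le> f n \<theta>"
        unfolding f_def cmod_def using p[of n] p[of m] by simp
    qed
  qed
  have lim: "AE \<theta> in unit_measure. (\<lambda>n. f n \<theta>) \<longlonglongrightarrow> - ln \<bar>cos (k * pi * \<theta>)\<bar>"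
    using ae
  proof eventually_elim
    case (elim \<theta>)
    have "(\<lambda>n. - ln (sqrt ((cos (k * pi * \<theta>))\<^sup>2 + (1 / Suc n * sin (k * pi * \<theta>))\<^sup>2)))
      \<longlonglongrightarrow> - ln (sqrt ((cos (k * pi * \<theta>))\<^sup>2 + (0 * sin (k * pi * \<theta>))\<^sup>2))"
      by (intro tendsto_intros) (use LIMSEQ_inverse_real_of_nat elim in \<open>auto simp: inverse_eq_divide\<close>)
    then show ?case by (simp add: f_def cmod_def)
  qed
  have m: "(\<lambda>\<theta>. - ln \<bar>cos (k * pi * \<theta>)\<bar>) \<in> borel_measurable unit_measure"
    by (rule measurable_unit_measure) measurable
  note * = integral_monotone_convergence_nonneg[OF 1 mono pos lim 2 m]
  show "integrable unit_measure (\<lambda>\<theta>. ln \<bar>cos (k * pi * \<theta>)\<bar>)"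
    using *(1) by simp
  show "(LINT \<theta>|unit_measure. ln \<bar>cos (k * pi * \<theta>)\<bar>) = - ln 2"
    using *(2) by simp
qed

text \<open>A + i B tan t is the ellipse point A cos t + i B sin t divided by cos t; the mean - ln 2
  of ln |cos t| cancels the factor 1/2 in ln ((A + |B|) / 2). \<open>B = 0\<close> is separate
  because the ellipse then degenerates.\<close>

lemma jensen_tan:
  assumes "A > 0" "0 < (k::nat)"
  shows "integrable unit_measure (\<lambda>\<theta>. ln (cmod (Complex A (B * tan (k * pi * \<theta>)))))"
    and "(LINT \<theta>|unit_measure. ln (cmod (Complex A (B * tan (k * pi * \<theta>))))) = ln (A + \<bar>B\<bar>)"
proof -
  have *: "integrable unit_measure (\<lambda>\<theta>. ln (cmod (Complex A (B * tan (k * pi * \<theta>))))) \<and>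
     (LINT \<theta>|unit_measure. ln (cmod (Complex A (B * tan (k * pi * \<theta>))))) = ln (A + \<bar>B\<bar>)"
  proof (cases "B = 0")
    case True
    then have "cmod (Complex A (B * tan (k * pi * \<theta>))) = A" for \<theta>
      using assms by (simp add: cmod_def)
    then show ?thesis using True by (simp add: unit.prob_space[simplified])
  next
    case False
    let ?g = "\<lambda>\<theta>. ln (cmod (Complex (A * cos (k * pi * \<theta>)) (\<bar>B\<bar> * sin (k * pi * \<theta>)))) - ln \<bar>cos (k * pi * \<theta>)\<bar>"
    have ae: "AE \<theta> in unit_measure. cos (k * pi * \<theta>) \<noteq> 0"
      using countable_cos_zeros[of "k * pi"] assms
      by (intro AE_unit_measure_countable) simp
    then have eq: "AE \<theta> in unit_measure. ln (cmod (Complex A (B * tan (k * pi * \<theta>)))) = ?g \<theta>"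
    proof eventually_elim
      case (elim \<theta>)
      define c where "c = cos (k * pi * \<theta>)"
      have c: "c \<noteq> 0" using elim c_def by simp
      have "(A * c)\<^sup>2 + (\<bar>B\<bar> * sin (k * pi * \<theta>))\<^sup>2 = c\<^sup>2 * (A\<^sup>2 + (B * tan (k * pi * \<theta>))\<^sup>2)"
        using c by (simp only: tan_def c_def[symmetric] power_mult_distrib power_divide power2_abs)
          (simp add: field_simps)
      then have "cmod (Complex (A * c) (\<bar>B\<bar> * sin (k * pi * \<theta>))) = \<bar>c\<bar> * cmod (Complex A (B * tan (k * pi * \<theta>)))"
        by (simp add: cmod_def real_sqrt_mult)
      moreover have "cmod (Complex A (B * tan (k * pi * \<theta>))) > 0"
        using assms by (auto simp: complex_eq_iff)
      ultimately show ?case using c by (simp add: c_def ln_mult)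
    qed
    have i: "integrable unit_measure ?g"
      using jensen_ellipse(1)[of A "\<bar>B\<bar>" k] jensen_cos(1)[of k] assms False by auto
    have "A + \<bar>B\<bar> > 0" using assms by linarith
    then have v: "integral\<^sup>L unit_measure ?g = ln (A + \<bar>B\<bar>)"
      using jensen_ellipse[of A "\<bar>B\<bar>" k] jensen_cos[of k] assms False by (simp add: ln_div)
    have m1: "(\<lambda>\<theta>. ln (cmod (Complex A (B * tan (k * pi * \<theta>))))) \<in> borel_measurable unit_measure"
      unfolding cmod_def tan_def complex.sel by (rule measurable_unit_measure) measurable
    show ?thesis
      using integrable_cong_AE[OF m1 borel_measurable_integrable[OF i] eq]
        integral_cong_AE[OF m1 borel_measurable_integrable[OF i] eq] i v by simp
  qed
  show "integrable unit_measure (\<lambda>\<theta>. ln (cmod (Complex A (B * tan (k * pi * \<theta>)))))"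
    and "(LINT \<theta>|unit_measure. ln (cmod (Complex A (B * tan (k * pi * \<theta>))))) = ln (A + \<bar>B\<bar>)"
    using * by auto
qed

lemma unit_circle_minus_inverse:
  "unit_circle \<theta> - inverse (unit_circle \<theta>) = Complex 0 (2 * sin (2 * pi * \<theta>))"
  by (simp add: unit_circle_eq_cis complex_eq_iff)

lemma unit_circle_plus_inverse:
  "unit_circle \<theta> + inverse (unit_circle \<theta>) = of_real (2 * cos (2 * pi * \<theta>))"
  by (simp add: unit_circle_eq_cis complex_eq_iff)

text \<open>With u = \<open>unit_circle \<theta>\<close>, 2 u (sinh w + i sin (2 pi theta)) = (u +
  e^w) (u - e^(-w)). One root lies inside the circle and the other, of modulus e^|w|, outside; for
  \<open>w = 0\<close> both would lie on it.\<close>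

lemma jensen_sinh:
  assumes "w \<noteq> 0"
  shows "integrable unit_measure (\<lambda>\<theta>. ln (cmod (Complex (sinh w) (sin (2 * pi * \<theta>)))))"
    and "(LINT \<theta>|unit_measure. ln (cmod (Complex (sinh w) (sin (2 * pi * \<theta>))))) = \<bar>w\<bar> - ln 2"
proof -
  have ne: "cmod (of_real (exp w)) \<noteq> cmod 1" "cmod (of_real (- exp (-w))) \<noteq> cmod 1"
    using assms by auto
  have nz: "a + 1 * unit_circle \<theta> \<noteq> 0" if "cmod a \<noteq> cmod 1" for a \<theta>
  proof
    assume "a + 1 * unit_circle \<theta> = 0"
    then have "a = - unit_circle \<theta>" by (simp add: add_eq_0_iff2)
    then show False using that by simp
  qed
  have eq: "ln (cmod (Complex (sinh w) (sin (2 * pi * \<theta>)))) =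
    ln (cmod (of_real (exp w) + 1 * unit_circle \<theta> ^ 1)) + ln (cmod (of_real (- exp (-w)) + 1 * unit_circle \<theta> ^ 1)) - ln 2" for \<theta>
  proof -
    let ?u = "unit_circle \<theta>"
    have ee: "complex_of_real (exp w) * complex_of_real (exp (-w)) = 1"
      by (simp flip: of_real_mult add: exp_minus_inverse)
    have "2 * Complex (sinh w) (sin (2 * pi * \<theta>)) = of_real (exp w - exp (-w)) + (?u - inverse ?u)"
      unfolding unit_circle_minus_inverse by (simp add: complex_eq_iff sinh_def)
    then have "?u * (2 * Complex (sinh w) (sin (2 * pi * \<theta>))) =
        ?u * of_real (exp w - exp (-w)) + (?u * ?u - ?u * inverse ?u)"
      by (simp only: distrib_left right_diff_distrib)
    also have "?u * inverse ?u = of_real (exp w) * of_real (exp (-w))"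
      using ee by simp
    also have "?u * of_real (exp w - exp (-w)) + (?u * ?u - of_real (exp w) * of_real (exp (-w))) =
        (of_real (exp w) + ?u) * (of_real (- exp (-w)) + ?u)"
      by (simp add: algebra_simps)
    finally have "?u * (2 * Complex (sinh w) (sin (2 * pi * \<theta>))) = (of_real (exp w) + ?u) * (of_real (- exp (-w)) + ?u)" .
    then have "cmod (?u * (2 * Complex (sinh w) (sin (2 * pi * \<theta>)))) = cmod (of_real (exp w) + ?u) * cmod (of_real (- exp (-w)) + ?u)"
      by (simp only: norm_mult)
    then have "cmod (Complex (sinh w) (sin (2 * pi * \<theta>))) = cmod (of_real (exp w) + ?u) * cmod (of_real (- exp (-w)) + ?u) / 2"
      by (simp add: norm_mult)
    moreover have "cmod (of_real (exp w) + ?u) > 0" "cmod (of_real (- exp (-w)) + ?u) > 0"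
      using nz[OF ne(1), of \<theta>] nz[OF ne(2), of \<theta>] by simp_all
    moreover have "ln (p * q / 2) = ln p + ln q - ln 2" if "p > 0" "q > 0" for p q :: real
      using that by (simp add: ln_div ln_mult)
    ultimately show ?thesis
      by (simp only: power_one_right mult_1)
  qed
  have "max (exp w) 1 = exp (max w 0)" "max (exp (-w)) 1 = exp (max (-w) 0)"
    by (auto simp: max_def)
  then show "integrable unit_measure (\<lambda>\<theta>. ln (cmod (Complex (sinh w) (sin (2 * pi * \<theta>)))))"
    and "(LINT \<theta>|unit_measure. ln (cmod (Complex (sinh w) (sin (2 * pi * \<theta>))))) = \<bar>w\<bar> - ln 2"
    unfolding eq using jensen_linear[OF ne(1), of 1] jensen_linear[OF ne(2), of 1]
    by (auto simp: unit.prob_space[simplified] simp del: power_one_right)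
qed

subsection \<open>The inverse tangent integral\<close>

lemma set_integral_reflect:
  fixes f :: "real \<Rightarrow> real"
  assumes int: "set_integrable lborel {0..2 * a} f" and "0 \<le> a" and sym: "\<And>x. f (2 * a - x) = f x"
  shows "(LBINT x:{0..2 * a}. f x) = 2 * (LBINT x:{0..a}. f x)"
proof -
  have i: "set_integrable lborel {0..a} f" "set_integrable lborel {a..2 * a} f"
    by (rule set_integrable_subset[OF int]; use assms in auto)+
  have "(LBINT x:{a..2 * a}. f x) =
      \<bar>- 1\<bar> *\<^sub>R (LINT x|lborel. indicator {a..2 * a} (2 * a + (-1) * x) *\<^sub>R f (2 * a + (-1) * x))"
    unfolding set_lebesgue_integral_def by (rule lborel_integral_real_affine) auto
  also have "(\<lambda>x::real. indicator {a..2 * a} (2 * a + (-1) * x)) = (indicator {0..a} :: real \<Rightarrow> real)"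
    by (auto simp: indicator_def)
  finally have refl: "(LBINT x:{a..2 * a}. f x) = (LBINT x:{0..a}. f x)"
    using sym by (simp add: set_lebesgue_integral_def)
  have un: "{0..2 * a} = {0..a} \<union> {a..2 * a}" using assms by auto
  have "(LBINT x:{0..2 * a}. f x) = (LBINT x:{0..a}. f x) + (LBINT x:{a..2 * a}. f x)"
    unfolding un
  proof (rule set_integral_Un_AE)
    show "AE x in lborel. \<not> (x \<in> {0..a} \<and> x \<in> {a..2 * a})"
      using AE_lborel_singleton[of a] by eventually_elim auto
  qed (use i in auto)
  then show ?thesis using refl by simp
qed

lemma set_integral_scale:
  fixes f :: "real \<Rightarrow> real"
  assumes "0 < c"
  shows "(LBINT u:{0..c * a}. f u) = c * (LBINT x:{0..a}. f (c * x))"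
proof -
  have "(LBINT u:{0..c * a}. f u) = \<bar>c\<bar> *\<^sub>R (LINT x|lborel. indicator {0..c * a} (0 + c * x) *\<^sub>R f (0 + c * x))"
    unfolding set_lebesgue_integral_def by (rule lborel_integral_real_affine) (use assms in auto)
  also have "(\<lambda>x. indicator {0..c * a} (0 + c * x)) = (indicator {0..a} :: real \<Rightarrow> real)"
    using assms by (auto simp: indicator_def fun_eq_iff zero_le_mult_iff)
  finally show ?thesis using assms by (simp add: set_lebesgue_integral_def)
qed

text \<open>The reflection theta -> 1 - theta changes the sign of the tangent and folds the interval
  in half; phi = pi theta then rescales it.\<close>

lemma unit_measure_tan:
  assumes "integrable unit_measure (\<lambda>\<theta>. f \<bar>tan (pi * \<theta>)\<bar>)"
  shows "(LINT \<theta>|unit_measure. f \<bar>tan (pi * \<theta>)\<bar>) = 2 / pi * (LBINT \<phi>:{0..pi / 2}. f (tan \<phi>))"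
proof -
  have t: "tan (pi * (1 - x)) = - tan (pi * x)" for x
    by (simp add: tan_def right_diff_distrib)
  have "(LINT \<theta>|unit_measure. f \<bar>tan (pi * \<theta>)\<bar>) = 2 * (LBINT \<theta>:{0..1/2}. f \<bar>tan (pi * \<theta>)\<bar>)"
    using set_integral_reflect[of "1/2" "\<lambda>\<theta>. f \<bar>tan (pi * \<theta>)\<bar>"] assms t
    by (simp add: integral_unit_measure integrable_unit_measure)
  moreover have "(LBINT \<phi>:{0..pi * (1/2)}. f \<bar>tan \<phi>\<bar>) = pi * (LBINT \<theta>:{0..1/2}. f \<bar>tan (pi * \<theta>)\<bar>)"
    by (rule set_integral_scale) simp
  moreover have "(LBINT \<phi>:{0..pi * (1/2)}. f \<bar>tan \<phi>\<bar>) = (LBINT \<phi>:{0..pi / 2}. f (tan \<phi>))"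
  proof -
    \<comment> \<open>This includes the endpoint pi / 2, where \<open>tan\<close> is a quotient by 0
      and hence 0.\<close>
    have "tan \<phi> \<ge> 0" if "0 \<le> \<phi>" "\<phi> \<le> pi / 2" for \<phi>
      unfolding tan_def using that
      by (intro divide_nonneg_nonneg sin_ge_zero cos_ge_zero) auto
    then show ?thesis by (auto intro!: set_lebesgue_integral_cong)
  qed
  ultimately show ?thesis by (simp add: field_simps)
qed

text \<open>Reflections about 1/2 and 1/4 reduce to a quarter period, and the rescaling by 2 pi
  leaves the constant 4 / (2 pi).\<close>

lemma unit_measure_sin:
  assumes "integrable unit_measure (\<lambda>\<theta>. f \<bar>sin (2 * pi * \<theta>)\<bar>)"
  shows "(LINT \<theta>|unit_measure. f \<bar>sin (2 * pi * \<theta>)\<bar>) = 2 / pi * (LBINT \<phi>:{0..pi / 2}. f (sin \<phi>))"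
proof -
  let ?f = "\<lambda>\<theta>. f \<bar>sin (2 * pi * \<theta>)\<bar>"
  have t: "sin (2 * pi * (1 - x)) = - sin (2 * pi * x)" 
          "sin (2 * pi * (1/2 - x)) = sin (2 * pi * x)" for x
    by (simp_all add: right_diff_distrib sin_diff)
  have i: "set_integrable lborel {0..1} ?f"
    using assms by (simp add: integrable_unit_measure)
  have "(LINT \<theta>|unit_measure. ?f \<theta>) = 2 * (LBINT \<theta>:{0..1/2}. ?f \<theta>)"
    using set_integral_reflect[of "1/2" ?f] i t(1)
    by (simp add: integral_unit_measure)
  also have "(LBINT \<theta>:{0..1/2}. ?f \<theta>) = 2 * (LBINT \<theta>:{0..1/4}. ?f \<theta>)"
    using set_integral_reflect[of "1/4" ?f] set_integrable_subset[OF i, of "{0..1/2}"] t(2)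
    by simp
  also have "(LBINT \<theta>:{0..1/4}. ?f \<theta>) = (LBINT \<phi>:{0..2 * pi * (1/4)}. f \<bar>sin \<phi>\<bar>) / (2 * pi)"
    using set_integral_scale[of "2 * pi" "1/4" "\<lambda>x. f \<bar>sin x\<bar>"] by simp
  also have "(LBINT \<phi>:{0..2 * pi * (1/4)}. f \<bar>sin \<phi>\<bar>) = (LBINT \<phi>:{0..pi / 2}. f (sin \<phi>))"
  proof -
    have "sin \<phi> \<ge> 0" if "0 \<le> \<phi>" "\<phi> \<le> pi / 2" for \<phi>
      using that by (intro sin_ge_zero) auto
    then show ?thesis by (auto intro!: set_lebesgue_integral_cong)
  qed
  finally show ?thesis by simp
qed

section \<open>The inverse tangent integral as a mean over an angle\<close>

text \<open>The quotient is 0 at u = 0 instead of its limit 1, which the integral does not see. For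
  negative \<open>s\<close> the interval is empty and the value 0, so the function is monotone on
  the whole line and therefore Borel.\<close>

definition ti2 :: "real \<Rightarrow> real" where
  "ti2 s = (LBINT u:{0..s}. arctan u / u)"

lemma arctan_over_self_nonneg: "0 \<le> arctan u / u"
  by (cases "u \<ge> 0") (auto simp: divide_nonneg_nonneg divide_nonpos_nonpos)

lemma arctan_over_self_le_1: "arctan u / u \<le> 1"
proof -
  have "\<bar>arctan u\<bar> \<le> \<bar>u\<bar>" by (rule abs_arctan_le)
  then have "\<bar>arctan u\<bar> / \<bar>u\<bar> \<le> 1" by (cases "u = 0") auto
  then show ?thesis by (metis abs_divide abs_ge_self order_trans)
qed

lemma set_integrable_bounded:
  fixes f :: "real \<Rightarrow> real"
  assumes "f \<in> borel_measurable borel" "\<And>x. x \<in> {a..b} \<Longrightarrow> \<bar>f x\<bar> \<le> B"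
  shows "set_integrable lborel {a..b} f"
  unfolding set_integrable_def
  by (rule integrableI_bounded_set_indicator[where B = B]) (use assms in \<open>auto simp: emeasure_lborel_Icc_eq\<close>)

lemma set_integrable_arctan_over_self: "set_integrable lborel {a..b} (\<lambda>u. arctan u / u)"
proof (rule set_integrable_bounded)
  show "\<bar>arctan u / u\<bar> \<le> 1" for u :: real
    unfolding abs_of_nonneg[OF arctan_over_self_nonneg] by (rule arctan_over_self_le_1)
qed measurable

lemma ti2_nonneg: "0 \<le> ti2 s"
  unfolding ti2_def set_lebesgue_integral_def
  by (intro integral_nonneg_AE AE_I2 scaleR_nonneg_nonneg arctan_over_self_nonneg) simp

lemma mono_ti2: "mono ti2"
  unfolding mono_def ti2_def set_lebesgue_integral_def
  by (intro allI impI integral_mono set_integrable_arctan_over_self[unfolded set_integrable_def]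
      scaleR_right_mono arctan_over_self_nonneg) (auto simp: indicator_def)

lemma measurable_ti2 [measurable]: "ti2 \<in> borel_measurable borel"
  by (rule borel_measurable_mono[OF mono_ti2])

text \<open>\<open>K b\<close> is recovered from its derivative \<open>k u b\<close> in
  \<open>u\<close>, and the double integral over the rectangle is taken in the other order. The mean
  over \<open>b\<close> is prescribed only for positive \<open>u\<close>: at 0 the quotient arctan u
  / u has the default value 0, and a single point may be ignored.\<close>

lemma ti2_swap:
  fixes k :: "real \<Rightarrow> real \<Rightarrow> real"
  assumes "0 \<le> s" and "continuous_on (cbox (0, 0) (s, pi / 2)) (\<lambda>(u, b). k u b)"
    and K: "\<And>b. b \<in> {0..pi / 2} \<Longrightarrow> ((\<lambda>u. k u b) has_integral K b) {0..s}"
    and c: "\<And>u. 0 < u \<Longrightarrow> ((\<lambda>b. k u b) has_integral c * (arctan u / u)) {0..pi / 2}"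
  shows "integral {0..pi / 2} K = c * ti2 s"
proof -
  have "integral {0..pi / 2} K = integral {0..pi / 2} (\<lambda>b. integral {0..s} (\<lambda>u. k u b))"
    by (rule integral_cong, rule integral_unique[symmetric], rule K)
  also have "\<dots> = integral {0..s} (\<lambda>u. integral {0..pi / 2} (\<lambda>b. k u b))"
    using integral_swap_continuous[OF assms(2)] by simp
  also have "\<dots> = integral {0..s} (\<lambda>u. c * (arctan u / u))"
    by (rule integral_spike[where S = "{0}"]) (use integral_unique[OF c] in auto)
  also have "\<dots> = c * ti2 s"
    unfolding ti2_def set_borel_integral_eq_integral(2)[OF set_integrable_arctan_over_self]
    by (rule integral_mult_right)
  finally show ?thesis .
qed

lemma sin_nonneg_quarter: "b \<in> {0..pi / 2} \<Longrightarrow> 0 \<le> sin b"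
  by (intro sin_ge_zero) auto

lemma unit_measure_sin_continuous:
  assumes "continuous_on UNIV f"
  shows "integrable unit_measure (\<lambda>\<theta>. f \<bar>sin (2 * pi * \<theta>)\<bar>)"
    and "(LINT \<theta>|unit_measure. f \<bar>sin (2 * pi * \<theta>)\<bar>) = 2 / pi * integral {0..pi / 2} (\<lambda>\<phi>. f (sin \<phi>))"
proof -
  have c: "continuous_on S (\<lambda>\<theta>. f (g \<theta>))" if "continuous_on S g" for S and g :: "real \<Rightarrow> real"
    using continuous_on_compose2[OF assms that] by auto
  have c1: "continuous_on {0..1} (\<lambda>\<theta>. f \<bar>sin (2 * pi * \<theta>)\<bar>)"
    by (intro c continuous_intros)
  show *: "integrable unit_measure (\<lambda>\<theta>. f \<bar>sin (2 * pi * \<theta>)\<bar>)"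
    using unit_measure_continuous[OF c1 integrable_integral[OF integrable_continuous_real[OF c1]]]
    by blast
  have "set_integrable lborel {0..pi / 2} (\<lambda>\<phi>. f (sin \<phi>))"
    by (rule borel_integrable_compact[simplified set_integrable_def[symmetric]])
       (auto intro!: c continuous_intros)
  then show "(LINT \<theta>|unit_measure. f \<bar>sin (2 * pi * \<theta>)\<bar>) = 2 / pi * integral {0..pi / 2} (\<lambda>\<phi>. f (sin \<phi>))"
    using unit_measure_sin[OF *] by (simp add: set_borel_integral_eq_integral(2))
qed

text \<open>The kernel sin b / sqrt (1 + (u sin b)^2) is the derivative of arsinh (u sin b) in u,
  and it also has an elementary antiderivative in b.\<close>

lemma arsinh_sin_mean:
  assumes "0 \<le> s"
  shows "integrable unit_measure (\<lambda>\<theta>. arsinh (s * \<bar>sin (2 * pi * \<theta>)\<bar>))"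
    and "(LINT \<theta>|unit_measure. arsinh (s * \<bar>sin (2 * pi * \<theta>)\<bar>)) = 2 / pi * ti2 s"
proof -
  have cont: "continuous_on UNIV (\<lambda>x. arsinh (s * x))"
    by (intro continuous_intros)
  have pos: "0 < 1 + (u * sin b)\<^sup>2" for u b :: real
    by (intro add_pos_nonneg) auto
  have "integral {0..pi / 2} (\<lambda>b. arsinh (s * sin b)) = 1 * ti2 s"
  proof (rule ti2_swap[where k = "\<lambda>u b. sin b / sqrt (1 + (u * sin b)\<^sup>2)"])
    show "continuous_on (cbox (0, 0) (s, pi / 2)) (\<lambda>(u, b). sin b / sqrt (1 + (u * sin b)\<^sup>2))"
      unfolding case_prod_unfold using pos by (intro continuous_intros) (auto simp: less_imp_neq[THEN not_sym])
    fix b :: real assume "b \<in> {0..pi / 2}"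
    have "((\<lambda>u. arsinh (u * sin b)) has_real_derivative sin b / sqrt (1 + (u * sin b)\<^sup>2)) (at u within X)" for u X
      using DERIV_chain2[OF arsinh_real_has_field_derivative DERIV_cmult_right[OF DERIV_ident], of "sin b" u X]
      by (simp add: add.commute)
    then have "((\<lambda>u. sin b / sqrt (1 + (u * sin b)\<^sup>2)) has_integral (arsinh (s * sin b) - arsinh (0 * sin b))) {0..s}"
      using assms
      by (intro fundamental_theorem_of_calculus) (auto simp flip: has_real_derivative_iff_has_vector_derivative)
    then show "((\<lambda>u. sin b / sqrt (1 + (u * sin b)\<^sup>2)) has_integral arsinh (s * sin b)) {0..s}"
      by simp
  next
    fix u :: real assume u: "0 < u"
    define S where "S b = sqrt (1 + (u * sin b)\<^sup>2)" for b
    have S: "S b > 0" for b using pos by (simp add: S_def)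
    have S2: "(S b)\<^sup>2 = 1 + (u * sin b)\<^sup>2" for b using pos[of u b] by (simp add: S_def)
    have dS: "(S has_real_derivative (u\<^sup>2 * sin b * cos b / S b)) (at b within X)" for b X
      unfolding S_def using pos[of u b]
      by (auto intro!: derivative_eq_intros simp: field_simps power2_eq_square)
    \<comment> \<open>The antiderivative - arctan (u cos b / S b) / u works because (S b)^2 + (u cos
      b)^2 is the constant 1 + u^2. Only the endpoint b = 0 contributes, where S is 1.\<close>
    have "((\<lambda>b. sin b / S b) has_integral (- arctan (u * cos (pi / 2) / S (pi / 2)) / u - (- arctan (u * cos 0 / S 0) / u))) {0..pi / 2}"
    proof (intro fundamental_theorem_of_calculus)
      fix b :: real
      let ?q = "u * cos b / S b"
      have "1 + ?q\<^sup>2 = ((S b)\<^sup>2 + (u * cos b)\<^sup>2) / (S b)\<^sup>2"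
        using S[of b] by (simp add: field_simps)
      also have "(S b)\<^sup>2 + (u * cos b)\<^sup>2 = 1 + u\<^sup>2"
        unfolding S2 power_mult_distrib using sin_cos_squared_add[of b] by algebra
      finally have q: "1 + ?q\<^sup>2 = (1 + u\<^sup>2) / (S b)\<^sup>2" .
      have "(- u * sin b) * S b - u * cos b * (u\<^sup>2 * sin b * cos b / S b) = - u * sin b * ((S b)\<^sup>2 + (u * cos b)\<^sup>2) / S b"
        using S[of b] by (simp add: field_simps power2_eq_square)
      also have "(S b)\<^sup>2 + (u * cos b)\<^sup>2 = 1 + u\<^sup>2" by fact
      finally have n: "(- u * sin b) * S b - u * cos b * (u\<^sup>2 * sin b * cos b / S b) = - u * sin b * (1 + u\<^sup>2) / S b" .
      have "((\<lambda>b. u * cos b / S b) has_real_derivative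
          ((- u * sin b) * S b - u * cos b * (u\<^sup>2 * sin b * cos b / S b)) / (S b * S b)) (at b within {0..pi / 2})"
        using S[of b] by (intro DERIV_divide dS) (auto intro!: derivative_eq_intros)
      then have "((\<lambda>b. - arctan (u * cos b / S b) / u) has_real_derivative
          - (inverse (1 + ?q\<^sup>2) * (((- u * sin b) * S b - u * cos b * (u\<^sup>2 * sin b * cos b / S b)) / (S b * S b))) / u) (at b within {0..pi / 2})"
        by (intro DERIV_cdivide DERIV_minus DERIV_chain2[OF DERIV_arctan])
      also have "- (inverse (1 + ?q\<^sup>2) * (((- u * sin b) * S b - u * cos b * (u\<^sup>2 * sin b * cos b / S b)) / (S b * S b))) / u = sin b / S b"
      proof -
        have "1 + u\<^sup>2 > 0" by (intro add_pos_nonneg) auto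
        then show ?thesis unfolding q n using S[of b] u by (simp add: power2_eq_square)
      qed
      finally show "((\<lambda>b. - arctan (u * cos b / S b) / u) has_vector_derivative sin b / S b) (at b within {0..pi / 2})"
        by (simp add: has_real_derivative_iff_has_vector_derivative)
    qed simp
    then show "((\<lambda>b. sin b / sqrt (1 + (u * sin b)\<^sup>2)) has_integral 1 * (arctan u / u)) {0..pi / 2}"
      by (simp add: S_def)
  qed (use assms in auto)
  then show "(LINT \<theta>|unit_measure. arsinh (s * \<bar>sin (2 * pi * \<theta>)\<bar>)) = 2 / pi * ti2 s"
    using unit_measure_sin_continuous(2)[OF cont] by simp
  show "integrable unit_measure (\<lambda>\<theta>. arsinh (s * \<bar>sin (2 * pi * \<theta>)\<bar>))"
    using unit_measure_sin_continuous(1)[OF cont] .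
qed

text \<open>For b in [0, pi/2], 1 + u^2 + 2 u sin b = |1 + w|^2 with w = i u e^(-ib). By the polar
  Cauchy-Riemann equations, the derivative of ln |1 + w|^2 in u is - (2/u) times the derivative of
  arg (1 + w) in b, where arg (1 + w) = arctan (u cos b / (1 + u sin b)). Integration over b leaves
  (2/u) arctan u.\<close>

lemma ln_sin_mean:
  assumes "0 \<le> s"
  shows "integrable unit_measure (\<lambda>\<theta>. ln (1 + s\<^sup>2 + 2 * s * \<bar>sin (2 * pi * \<theta>)\<bar>))"
    and "(LINT \<theta>|unit_measure. ln (1 + s\<^sup>2 + 2 * s * \<bar>sin (2 * pi * \<theta>)\<bar>)) = 4 / pi * ti2 s"
proof -
  \<comment> \<open>The absolute value keeps the argument positive for every real x, as continuity
    is needed on the whole line; it is dropped again on [0, pi/2].\<close>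
  have cont: "continuous_on UNIV (\<lambda>x. ln (1 + s\<^sup>2 + 2 * s * \<bar>x\<bar>))"
  proof -
    have "1 + s\<^sup>2 + 2 * s * \<bar>x\<bar> > 0" for x
      using assms by (intro add_pos_nonneg) auto
    then show ?thesis by (intro continuous_intros) (auto simp: less_imp_neq[THEN not_sym])
  qed
  have pos: "0 < 1 + u\<^sup>2 + 2 * u * sin b" if "0 \<le> u" "b \<in> {0..pi / 2}" for u b :: real
    using that sin_nonneg_quarter[OF that(2)] by (intro add_pos_nonneg) auto
  have "integral {0..pi / 2} (\<lambda>b. ln (1 + s\<^sup>2 + 2 * s * sin b)) = 2 * ti2 s"
  proof (rule ti2_swap[where k = "\<lambda>u b. (2 * u + 2 * sin b) / (1 + u\<^sup>2 + 2 * u * sin b)"])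
    show "continuous_on (cbox (0, 0) (s, pi / 2)) (\<lambda>(u, b). (2 * u + 2 * sin b) / (1 + u\<^sup>2 + 2 * u * sin b))"
      unfolding case_prod_unfold using pos
      by (intro continuous_intros) (auto simp: cbox_Pair_eq less_imp_neq[THEN not_sym])
    fix b :: real assume b: "b \<in> {0..pi / 2}"
    have "((\<lambda>u. (2 * u + 2 * sin b) / (1 + u\<^sup>2 + 2 * u * sin b)) has_integral
        (ln (1 + s\<^sup>2 + 2 * s * sin b) - ln (1 + 0\<^sup>2 + 2 * 0 * sin b))) {0..s}"
      using assms pos[OF _ b]
      by (intro fundamental_theorem_of_calculus)
         (auto intro!: derivative_eq_intros simp flip: has_real_derivative_iff_has_vector_derivative)
    then show "((\<lambda>u. (2 * u + 2 * sin b) / (1 + u\<^sup>2 + 2 * u * sin b)) has_integral ln (1 + s\<^sup>2 + 2 * s * sin b)) {0..s}"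
      by simp
  next
    fix u :: real assume u: "0 < u"
    have "((\<lambda>b. (2 * u + 2 * sin b) / (1 + u\<^sup>2 + 2 * u * sin b)) has_integral
      (- (2 / u) * arctan (u * cos (pi / 2) / (1 + u * sin (pi / 2))) - (- (2 / u) * arctan (u * cos 0 / (1 + u * sin 0))))) {0..pi / 2}"
    proof (intro fundamental_theorem_of_calculus)
      fix b :: real assume b: "b \<in> {0..pi / 2}"
      define d where "d = 1 + u * sin b"
      have d: "d > 0" unfolding d_def using u sin_nonneg_quarter[OF b] by (intro add_pos_nonneg) auto
      have e: "d\<^sup>2 + (u * cos b)\<^sup>2 = 1 + u\<^sup>2 + 2 * u * sin b"
      proof -
        show ?thesis
          unfolding d_def using sin_cos_squared_add[of b] by algebra
      qed
      have n: "(- u * sin b) * d - u * cos b * (u * cos b) = - u * (u + sin b)"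
      proof -
        show ?thesis
          unfolding d_def using sin_cos_squared_add[of b] by algebra
      qed
      have "((\<lambda>b. u * cos b / (1 + u * sin b)) has_real_derivative
          ((- u * sin b) * d - u * cos b * (u * cos b)) / (d * d)) (at b within {0..pi / 2})"
        unfolding d_def using d by (intro DERIV_divide) (auto intro!: derivative_eq_intros simp: d_def)
      then have "((\<lambda>b. - (2 / u) * arctan (u * cos b / (1 + u * sin b))) has_real_derivative
          - (2 / u) * (inverse (1 + (u * cos b / d)\<^sup>2) * (((- u * sin b) * d - u * cos b * (u * cos b)) / (d * d)))) (at b within {0..pi / 2})"
        unfolding d_def by (intro DERIV_cmult DERIV_chain2[OF DERIV_arctan]) auto
      also have "1 + (u * cos b / d)\<^sup>2 = (1 + u\<^sup>2 + 2 * u * sin b) / d\<^sup>2"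
        unfolding e[symmetric] using d by (simp add: field_simps)
      also have "- (2 / u) * (inverse ((1 + u\<^sup>2 + 2 * u * sin b) / d\<^sup>2) * (((- u * sin b) * d - u * cos b * (u * cos b)) / (d * d)))
          = (2 * u + 2 * sin b) / (1 + u\<^sup>2 + 2 * u * sin b)"
      proof -
        define q where "q = 1 + u\<^sup>2 + 2 * u * sin b"
        have "q > 0" using u pos[of u b] b by (simp add: q_def)
        then show ?thesis
          unfolding n q_def[symmetric] using d u by (simp add: power2_eq_square diff_divide_distrib add_divide_distrib)
      qed
      finally show "((\<lambda>b. - (2 / u) * arctan (u * cos b / (1 + u * sin b))) has_vector_derivative
          (2 * u + 2 * sin b) / (1 + u\<^sup>2 + 2 * u * sin b)) (at b within {0..pi / 2})"
        by (simp add: has_real_derivative_iff_has_vector_derivative)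
    qed simp
    then show "((\<lambda>b. (2 * u + 2 * sin b) / (1 + u\<^sup>2 + 2 * u * sin b)) has_integral 2 * (arctan u / u)) {0..pi / 2}"
      by simp
  qed (use assms in auto)
  moreover have "integral {0..pi / 2} (\<lambda>b. ln (1 + s\<^sup>2 + 2 * s * \<bar>sin b\<bar>)) = integral {0..pi / 2} (\<lambda>b. ln (1 + s\<^sup>2 + 2 * s * sin b))"
    by (rule integral_cong) (use sin_nonneg_quarter in auto)
  ultimately show "(LINT \<theta>|unit_measure. ln (1 + s\<^sup>2 + 2 * s * \<bar>sin (2 * pi * \<theta>)\<bar>)) = 4 / pi * ti2 s"
    using unit_measure_sin_continuous(2)[OF cont] by simp
  show "integrable unit_measure (\<lambda>\<theta>. ln (1 + s\<^sup>2 + 2 * s * \<bar>sin (2 * pi * \<theta>)\<bar>))"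
    using unit_measure_sin_continuous(1)[OF cont] by simp
qed

section \<open>Logarithmic growth and integrability against the half-Cauchy law\<close>

text \<open>Since 1 + B |t| is at most 2 |1 + i B t| and both logarithms are nonnegative, the
  integrable logarithm of \<open>jensen_tan\<close> dominates.\<close>

lemma integrable_ln_tan:
  assumes "0 \<le> B" "0 < (k::nat)"
  shows "integrable unit_measure (\<lambda>\<theta>. ln (1 + B * \<bar>tan (k * pi * \<theta>)\<bar>))"
proof (rule Bochner_Integration.integrable_bound)
  show "integrable unit_measure (\<lambda>\<theta>. ln 2 + ln (cmod (Complex 1 (B * tan (k * pi * \<theta>)))))"
    by (intro Bochner_Integration.integrable_add jensen_tan(1)) (use assms in auto)
  show "(\<lambda>\<theta>. ln (1 + B * \<bar>tan (k * pi * \<theta>)\<bar>)) \<in> borel_measurable unit_measure"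
    unfolding tan_def by (rule measurable_unit_measure) measurable
  have "norm (ln (1 + B * \<bar>t\<bar>)) \<le> norm (ln 2 + ln (cmod (Complex 1 (B * t))))" for t
  proof -
    have "\<bar>Re (Complex 1 (B * t))\<bar> \<le> cmod (Complex 1 (B * t))" "\<bar>Im (Complex 1 (B * t))\<bar> \<le> cmod (Complex 1 (B * t))"
      by (rule abs_Re_le_cmod abs_Im_le_cmod)+
    then have c: "1 \<le> cmod (Complex 1 (B * t))" "B * \<bar>t\<bar> \<le> cmod (Complex 1 (B * t))"
      using assms by (auto simp: abs_mult)
    have "0 \<le> B * \<bar>t\<bar>" using assms by simp
    then have "0 \<le> ln (1 + B * \<bar>t\<bar>)" by simp
    moreover have "ln (1 + B * \<bar>t\<bar>) \<le> ln (2 * cmod (Complex 1 (B * t)))"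
      using c \<open>0 \<le> B * \<bar>t\<bar>\<close> by (intro ln_le_cancel_iff[THEN iffD2]) linarith+
    moreover have "ln (2 * cmod (Complex 1 (B * t))) = ln 2 + ln (cmod (Complex 1 (B * t)))"
      by (simp add: ln_mult complex_eq_iff)
    ultimately show ?thesis by simp
  qed
  then show "AE \<theta> in unit_measure. norm (ln (1 + B * \<bar>tan (k * pi * \<theta>)\<bar>))
      \<le> norm (ln 2 + ln (cmod (Complex 1 (B * tan (k * pi * \<theta>)))))"
    by simp
qed

text \<open>In the mean \<open>arsinh_sin_mean\<close> the integrand obeys arsinh w \<le> ln (2 w +
  1) \<le> 2 ln (1 + s) for 0 \<le> w \<le> s. Logarithmic growth is what makes \<open>ti2\<close>
  integrable against the heavy-tailed Cauchy law.\<close>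

lemma ti2_le_ln:
  assumes "0 \<le> s"
  shows "ti2 s \<le> pi * ln (1 + s)"
proof -
  have "arsinh (s * \<bar>sin (2 * pi * \<theta>)\<bar>) \<le> 2 * ln (1 + s)" for \<theta>
  proof -
    define w where "w = s * \<bar>sin (2 * pi * \<theta>)\<bar>"
    have w: "0 \<le> w" "w \<le> s"
      using assms by (auto simp: w_def intro: mult_left_le)
    have "sqrt (w\<^sup>2 + 1) \<le> w + 1"
      by (rule real_le_lsqrt) (use w in \<open>auto simp: power2_eq_square algebra_simps\<close>)
    then have "w + sqrt (w\<^sup>2 + 1) \<le> (1 + s)\<^sup>2"
      using w by (simp add: power2_eq_square algebra_simps) (smt (verit) mult_nonneg_nonneg)
    moreover have "0 < w + sqrt (w\<^sup>2 + 1)"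
      using w by (intro add_nonneg_pos) (auto intro: add_nonneg_pos)
    ultimately have "ln (w + sqrt (w\<^sup>2 + 1)) \<le> ln ((1 + s)\<^sup>2)"
      by (intro ln_le_cancel_iff[THEN iffD2]) linarith+
    then show ?thesis using assms by (simp add: w_def[symmetric] arsinh_real_def ln_realpow)
  qed
  then have "(LINT \<theta>|unit_measure. arsinh (s * \<bar>sin (2 * pi * \<theta>)\<bar>)) \<le> (LINT \<theta>|unit_measure. 2 * ln (1 + s))"
    by (intro integral_mono arsinh_sin_mean assms) auto
  then have "2 / pi * ti2 s \<le> 2 * ln (1 + s)"
    using arsinh_sin_mean(2)[OF assms] by (simp add: unit.prob_space[simplified])
  then show ?thesis by (simp add: field_simps)
qed

lemma integrable_ti2_tan:
  assumes "0 \<le> B"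
  shows "integrable unit_measure (\<lambda>\<theta>. ti2 (B * \<bar>tan (pi * \<theta>)\<bar>))"
proof (rule Bochner_Integration.integrable_bound)
  show "integrable unit_measure (\<lambda>\<theta>. pi * ln (1 + B * \<bar>tan (pi * \<theta>)\<bar>))"
    using integrable_ln_tan[OF assms, of 1] by simp
  show "(\<lambda>\<theta>. ti2 (B * \<bar>tan (pi * \<theta>)\<bar>)) \<in> borel_measurable unit_measure"
    unfolding tan_def by (rule measurable_unit_measure) measurable
  show "AE \<theta> in unit_measure. norm (ti2 (B * \<bar>tan (pi * \<theta>)\<bar>)) \<le> norm (pi * ln (1 + B * \<bar>tan (pi * \<theta>)\<bar>))"
    using ti2_nonneg ti2_le_ln[of "B * \<bar>tan (pi * _)\<bar>"] assms
    by (intro AE_I2) (smt (verit) mult_nonneg_nonneg real_norm_def abs_ge_zero)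
qed

text \<open>Averaging \<open>ti2\<close> against the Cauchy distribution of scale \<open>v\<^sup>2\<close> weights \<open>arctan u / u\<close> with
  the tail probability of \<open>u\<close>; the result is invariant under the inversion \<open>u \<mapsto> v\<^sup>2 / u\<close>.\<close>

definition ti2_tail :: "real \<Rightarrow> real \<Rightarrow> real" where
  "ti2_tail v u = arctan u / u * (pi / 2 - arctan (u / v\<^sup>2))"

lemma ti2_tail_nonneg: "0 \<le> ti2_tail v u"
  unfolding ti2_tail_def using arctan_ubound[of "u / v\<^sup>2"]
  by (intro mult_nonneg_nonneg arctan_over_self_nonneg) auto

lemma set_integrable_ti2_tail: "set_integrable lborel {a..b} (ti2_tail v)"
proof (rule set_integrable_bounded)
  show "\<bar>ti2_tail v u\<bar> \<le> 1 * pi" for u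
    unfolding ti2_tail_def abs_mult
    using arctan_over_self_le_1[of u] arctan_over_self_nonneg[of u] arctan_bounded[of "u / v\<^sup>2"]
    by (intro mult_mono) auto
  show "ti2_tail v \<in> borel_measurable borel"
    unfolding ti2_tail_def by measurable
qed

text \<open>Under u = v x the factors become arctan (v x) and arctan (x / v), while du / u is
  unchanged; this is the origin of the arguments v and 1/v of \<open>T_arctan\<close>.\<close>

lemma ti2_tail_integral:
  assumes "v > 0"
  shows "(LBINT u:{0..v}. ti2_tail v u) = pi / 2 * ti2 v - T_arctan v (1 / v)"
proof -
  have i: "set_integrable lborel {0..v} (\<lambda>u. arctan u * arctan (u / v\<^sup>2) / u)"
  proof (rule set_integrable_bounded)
    fix u :: real
    have "\<bar>arctan u * arctan (u / v\<^sup>2) / u\<bar> = \<bar>arctan u / u\<bar> * \<bar>arctan (u / v\<^sup>2)\<bar>"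
      by (simp add: abs_mult)
    also have "\<dots> \<le> 1 * pi"
      using arctan_over_self_le_1[of u] arctan_over_self_nonneg[of u] arctan_bounded[of "u / v\<^sup>2"]
      by (intro mult_mono) auto
    finally show "\<bar>arctan u * arctan (u / v\<^sup>2) / u\<bar> \<le> 1 * pi" .
  qed measurable
  have i': "set_integrable lborel {0..v} (\<lambda>u. pi / 2 * (arctan u / u))"
    by (rule set_integrable_mult_right) (rule set_integrable_arctan_over_self)
  have "(LBINT u:{0..v}. ti2_tail v u) = (LBINT u:{0..v}. pi / 2 * (arctan u / u) - arctan u * arctan (u / v\<^sup>2) / u)"
    by (simp add: ti2_tail_def algebra_simps diff_divide_distrib)
  also have "\<dots> = pi / 2 * ti2 v - (LBINT u:{0..v * 1}. arctan u * arctan (u / v\<^sup>2) / u)"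
    unfolding ti2_def mult_1_right set_integral_diff(2)[OF i' i] set_integral_mult_right ..
  also have "(LBINT u:{0..v * 1}. arctan u * arctan (u / v\<^sup>2) / u) = T_arctan v (1 / v)"
    unfolding set_integral_scale[OF assms] T_arctan_def set_integral_mult_right[symmetric]
    using assms by (intro set_lebesgue_integral_cong) (auto simp: power2_eq_square)
  finally show ?thesis .
qed

text \<open>The inversion fixes v, exchanges (0, v) with the half-line beyond v, and preserves the
  integrand together with its differential.\<close>

lemma ti2_tail_inversion:
  assumes "v > 0"
  shows "set_integrable lborel {v<..} (ti2_tail v)"
    and "(LBINT u:{v<..}. ti2_tail v u) = (LBINT u:{0..v}. ti2_tail v u)"
proof -
  let ?g = "\<lambda>p. v\<^sup>2 / p"
  have img: "?g ` {0<..<v} = {v<..}"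
  proof
    show "?g ` {0<..<v} \<subseteq> {v<..}"
      using assms by (auto simp: field_simps power2_eq_square)
    show "{v<..} \<subseteq> ?g ` {0<..<v}"
    proof
      fix u assume "u \<in> {v<..}"
      then have "u = ?g (v\<^sup>2 / u)" "v\<^sup>2 / u \<in> {0<..<v}"
        using assms by (auto simp: field_simps power2_eq_square)
      then show "u \<in> ?g ` {0<..<v}" by blast
    qed
  qed
  \<comment> \<open>Each arctangent turns into the complement of the other one's argument, so the
    two factors of \<open>ti2_tail\<close> exchange roles, and du / u is invariant up to
    sign.\<close>
  have eq: "\<bar>- (v\<^sup>2 / p\<^sup>2)\<bar> * ti2_tail v (v\<^sup>2 / p) = ti2_tail v p" if "p \<in> {0<..<v}" for p
  proof -
    have p: "p > 0" using that by simp
    have 1: "arctan (v\<^sup>2 / p) = pi / 2 - arctan (p / v\<^sup>2)"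
      using arctan_inverse[of "p / v\<^sup>2"] p assms by (simp add: sgn_if)
    have 2: "arctan (v\<^sup>2 / p / v\<^sup>2) = pi / 2 - arctan p"
      using arctan_inverse[of p] p assms by (simp add: sgn_if inverse_eq_divide)
    show ?thesis
      unfolding ti2_tail_def 1 2 using p assms by (simp add: field_simps power2_eq_square)
  qed
  have sub: "set_integrable lborel {0<..<v} (ti2_tail v)"
    by (rule set_integrable_subset[OF set_integrable_ti2_tail[of 0 v]]) auto
  have ai: "ti2_tail v absolutely_integrable_on {0<..<v}"
    using sub by (simp add: set_integrable_def integrable_completion)
  have int: "integral {0<..<v} (ti2_tail v) = (LBINT u:{0<..<v}. ti2_tail v u)"
    using set_borel_integral_eq_integral(2)[OF sub] by simp
  \<comment> \<open>The open interval is forced by the singularity of the inversion at 0; the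
    endpoints form a null set.\<close>
  have oc: "(LBINT u:{0<..<v}. ti2_tail v u) = (LBINT u:{0..v}. ti2_tail v u)"
    unfolding set_lebesgue_integral_def
  proof (rule integral_cong_AE)
    show "AE x in lborel. indicat_real {0<..<v} x *\<^sub>R ti2_tail v x = indicat_real {0..v} x *\<^sub>R ti2_tail v x"
      using AE_lborel_singleton[of 0] AE_lborel_singleton[of v]
      by eventually_elim (auto simp: indicator_def)
  qed (unfold ti2_tail_def, measurable)
  have "((\<lambda>p. \<bar>- (v\<^sup>2 / p\<^sup>2)\<bar> * ti2_tail v (v\<^sup>2 / p)) absolutely_integrable_on {0<..<v}) \<longleftrightarrow>
      ti2_tail v absolutely_integrable_on {0<..<v}"
    by (rule set_integrable_cong) (use eq in auto)
  moreover have "integral {0<..<v} (\<lambda>p. \<bar>- (v\<^sup>2 / p\<^sup>2)\<bar> * ti2_tail v (v\<^sup>2 / p)) = integral {0<..<v} (ti2_tail v)"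
    by (rule integral_cong) (use eq in auto)
  ultimately have "(\<lambda>p. \<bar>- (v\<^sup>2 / p\<^sup>2)\<bar> * ti2_tail v (v\<^sup>2 / p)) absolutely_integrable_on {0<..<v} \<and>
      integral {0<..<v} (\<lambda>p. \<bar>- (v\<^sup>2 / p\<^sup>2)\<bar> * ti2_tail v (v\<^sup>2 / p)) = (LBINT u:{0..v}. ti2_tail v u)"
    using ai int oc by simp
  then have *: "ti2_tail v absolutely_integrable_on ?g ` {0<..<v} \<and>
      integral (?g ` {0<..<v}) (ti2_tail v) = (LBINT u:{0..v}. ti2_tail v u)"
    by (subst (asm) has_absolute_integral_change_of_variables_1')
       (use assms in \<open>auto intro!: derivative_eq_intros inj_onI simp: power2_eq_square field_simps\<close>)
  have m: "(\<lambda>u. indicat_real {v<..} u *\<^sub>R ti2_tail v u) \<in> borel_measurable lborel"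
    unfolding ti2_tail_def by measurable
  show s: "set_integrable lborel {v<..} (ti2_tail v)"
    using * m unfolding img set_integrable_def by (simp add: integrable_completion)
  show "(LBINT u:{v<..}. ti2_tail v u) = (LBINT u:{0..v}. ti2_tail v u)"
    using * set_borel_integral_eq_integral(2)[OF s] unfolding img by simp
qed

lemma ti2_tan_mean:
  assumes "v > 0"
  shows "(LINT \<theta>|unit_measure. ti2 (v\<^sup>2 * \<bar>tan (pi * \<theta>)\<bar>)) = 2 * ti2 v - 4 / pi * T_arctan v (1 / v)"
proof -
  define I where "I = pi * ti2 v - 2 * T_arctan v (1 / v)"
  \<comment> \<open>The region below the graph of v^2 tan phi; the strict bounds keep clear of the
    pole at pi / 2. As \<open>h\<close> takes values in the extended nonnegative reals, the order of
    integration can be exchanged without an integrability condition.\<close>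
  define h where "h \<phi> u = (if 0 < \<phi> \<and> \<phi> < pi / 2 \<and> 0 < u \<and> u < v\<^sup>2 * (sin \<phi> / cos \<phi>) then ennreal (arctan u / u) else 0)" for \<phi> u
  have [measurable]: "case_prod h \<in> borel_measurable (borel \<Otimes>\<^sub>M borel)"
    unfolding h_def case_prod_unfold by measurable
  have "(\<integral>\<^sup>+ \<phi>. ennreal (indicator {0..pi / 2} \<phi> * ti2 (v\<^sup>2 * tan \<phi>)) \<partial>lborel) = (\<integral>\<^sup>+ \<phi>. \<integral>\<^sup>+ u. h \<phi> u \<partial>lborel \<partial>lborel)"
  proof (rule nn_integral_cong_AE)
    show "AE \<phi> in lborel. ennreal (indicator {0..pi / 2} \<phi> * ti2 (v\<^sup>2 * tan \<phi>)) = (\<integral>\<^sup>+ u. h \<phi> u \<partial>lborel)"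
      using AE_lborel_singleton[of 0] AE_lborel_singleton[of "pi / 2"]
    proof eventually_elim
      case (elim \<phi>)
      show ?case
      proof (cases "0 < \<phi> \<and> \<phi> < pi / 2")
        case True
        have "(\<integral>\<^sup>+ u. h \<phi> u \<partial>lborel) = (\<integral>\<^sup>+ u. ennreal (indicator {0..v\<^sup>2 * tan \<phi>} u *\<^sub>R (arctan u / u)) \<partial>lborel)"
        proof (rule nn_integral_cong_AE)
          show "AE u in lborel. h \<phi> u = ennreal (indicator {0..v\<^sup>2 * tan \<phi>} u *\<^sub>R (arctan u / u))"
            using AE_lborel_singleton[of 0] AE_lborel_singleton[of "v\<^sup>2 * tan \<phi>"]
            by eventually_elim (use True in \<open>auto simp: h_def indicator_def tan_def\<close>)
        qed
        also have "\<dots> = ennreal (ti2 (v\<^sup>2 * tan \<phi>))"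
          unfolding ti2_def set_lebesgue_integral_def
          by (rule nn_integral_eq_integral)
             (use set_integrable_arctan_over_self arctan_over_self_nonneg in \<open>auto simp: set_integrable_def indicator_def\<close>)
        finally show ?thesis using True by simp
      next
        case False
        then have "\<phi> \<notin> {0..pi / 2}" using elim by auto
        moreover have "h \<phi> u = 0" for u using False by (auto simp: h_def)
        ultimately show ?thesis by simp
      qed
    qed
  qed
  also have "\<dots> = (\<integral>\<^sup>+ u. \<integral>\<^sup>+ \<phi>. h \<phi> u \<partial>lborel \<partial>lborel)"
    by (rule lborel_pair.Fubini') measurable
  also have "\<dots> = (\<integral>\<^sup>+ u. ennreal (indicator {0..v} u *\<^sub>R ti2_tail v u) + ennreal (indicator {v<..} u *\<^sub>R ti2_tail v u) \<partial>lborel)"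
  proof (rule nn_integral_cong_AE)
    show "AE u in lborel. (\<integral>\<^sup>+ \<phi>. h \<phi> u \<partial>lborel) =
        ennreal (indicator {0..v} u *\<^sub>R ti2_tail v u) + ennreal (indicator {v<..} u *\<^sub>R ti2_tail v u)"
      using AE_lborel_singleton[of 0]
    proof eventually_elim
      case (elim u)
      show ?case
      proof (cases "0 < u")
        case True
        have "(\<integral>\<^sup>+ \<phi>. h \<phi> u \<partial>lborel) = (\<integral>\<^sup>+ \<phi>. ennreal (arctan u / u) * indicator {arctan (u / v\<^sup>2)<..<pi / 2} \<phi> \<partial>lborel)"
        proof (rule nn_integral_cong)
          fix \<phi> :: real
          have "0 < arctan (u / v\<^sup>2)" using True assms by simp
          \<comment> \<open>The slice at height u is therefore an interval of length pi/2 - arctan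
            (u / v^2), the second factor of \<open>ti2_tail\<close>.\<close>
          moreover have "u < v\<^sup>2 * (sin \<phi> / cos \<phi>) \<longleftrightarrow> arctan (u / v\<^sup>2) < \<phi>" if "0 < \<phi>" "\<phi> < pi / 2"
          proof -
            have "u < v\<^sup>2 * (sin \<phi> / cos \<phi>) \<longleftrightarrow> u / v\<^sup>2 < tan \<phi>"
              using assms by (simp add: tan_def field_simps)
            also have "\<dots> \<longleftrightarrow> arctan (u / v\<^sup>2) < arctan (tan \<phi>)"
              by (simp add: arctan_less_iff)
            also have "arctan (tan \<phi>) = \<phi>" using that by (intro arctan_tan) auto
            finally show ?thesis .
          qed
          ultimately show "h \<phi> u = ennreal (arctan u / u) * indicator {arctan (u / v\<^sup>2)<..<pi / 2} \<phi>"
            using True unfolding h_def by (auto simp: indicator_def simp del: zero_less_arctan_iff)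
        qed
        also have "\<dots> = ennreal (arctan u / u) * ennreal (pi / 2 - arctan (u / v\<^sup>2))"
          using arctan_ubound[of "u / v\<^sup>2"] by (simp add: nn_integral_cmult)
        also have "\<dots> = ennreal (ti2_tail v u)"
          unfolding ti2_tail_def using arctan_over_self_nonneg[of u] arctan_ubound[of "u / v\<^sup>2"]
          by (subst ennreal_mult) auto
        finally show ?thesis using True by (auto simp: indicator_def)
      next
        case False
        then show ?thesis using elim assms by (auto simp: h_def indicator_def)
      qed
    qed
  qed
  also have "\<dots> = (\<integral>\<^sup>+ u. ennreal (indicator {0..v} u *\<^sub>R ti2_tail v u) \<partial>lborel)
      + (\<integral>\<^sup>+ u. ennreal (indicator {v<..} u *\<^sub>R ti2_tail v u) \<partial>lborel)"
    by (rule nn_integral_add) (unfold ti2_tail_def, measurable)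
  also have "\<dots> = ennreal (LBINT u:{0..v}. ti2_tail v u) + ennreal (LBINT u:{v<..}. ti2_tail v u)"
    unfolding set_lebesgue_integral_def
    by (subst (1 2) nn_integral_eq_integral)
       (use set_integrable_ti2_tail[of 0 v v] ti2_tail_inversion(1)[OF assms] ti2_tail_nonneg
        in \<open>auto simp: set_integrable_def indicator_def\<close>)
  also have "\<dots> = ennreal (2 * (LBINT u:{0..v}. ti2_tail v u))"
  proof -
    have "0 \<le> (LBINT u:{0..v}. ti2_tail v u)"
      unfolding set_lebesgue_integral_def
      by (intro integral_nonneg_AE AE_I2 scaleR_nonneg_nonneg ti2_tail_nonneg) simp
    then show ?thesis unfolding ti2_tail_inversion(2)[OF assms] by (simp flip: ennreal_plus)
  qed
  finally have nn: "(\<integral>\<^sup>+ \<phi>. ennreal (indicator {0..pi / 2} \<phi> * ti2 (v\<^sup>2 * tan \<phi>)) \<partial>lborel)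
      = ennreal (2 * (LBINT u:{0..v}. ti2_tail v u))" .
  have "0 \<le> (LBINT u:{0..v}. ti2_tail v u)"
    unfolding set_lebesgue_integral_def
    by (intro integral_nonneg_AE AE_I2 scaleR_nonneg_nonneg ti2_tail_nonneg) simp
  then have "(LINT \<phi>|lborel. indicator {0..pi / 2} \<phi> * ti2 (v\<^sup>2 * tan \<phi>)) = 2 * (LBINT u:{0..v}. ti2_tail v u)"
    using nn by (subst integral_eq_nn_integral) (auto simp: tan_def ti2_nonneg)
  then have "(LBINT \<phi>:{0..pi / 2}. ti2 (v\<^sup>2 * tan \<phi>)) = I"
    unfolding ti2_tail_integral[OF assms] by (simp add: set_lebesgue_integral_def I_def)
  then have "(LINT \<theta>|unit_measure. ti2 (v\<^sup>2 * \<bar>tan (pi * \<theta>)\<bar>)) = 2 / pi * I"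
    using unit_measure_tan[of "\<lambda>t. ti2 (v\<^sup>2 * t)"] integrable_ti2_tan[of "v\<^sup>2"] by simp
  then show ?thesis by (simp add: I_def right_diff_distrib)
qed

subsection \<open>Iterated integration over the torus\<close>

interpretation unit_product: product_sigma_finite "\<lambda>_::nat. unit_measure"
  by standard

abbreviation torus :: "nat set \<Rightarrow> (nat \<Rightarrow> real) measure" where
  "torus I \<equiv> Pi\<^sub>M I (\<lambda>_. unit_measure)"

lemma measurable_torus_compose:
  "i \<in> I \<Longrightarrow> f \<in> measurable unit_measure M \<Longrightarrow> (\<lambda>\<theta>. f (\<theta> i)) \<in> measurable (torus I) M"
  by (rule measurable_compose[OF measurable_component_singleton[where M = "\<lambda>_. unit_measure"]])

lemma measurable_torus_component: "i \<in> I \<Longrightarrow> (\<lambda>\<theta>. \<theta> i) \<in> borel_measurable (torus I)"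
  by (rule measurable_torus_compose[OF _ measurable_unit_measure]) auto

lemma AE_torus_component: "i \<in> I \<Longrightarrow> AE x in unit_measure. P x \<Longrightarrow> AE \<theta> in torus I. P (\<theta> i)"
  by (rule AE_PiM_component[where M = "\<lambda>_. unit_measure"]) (auto intro: prob_space_unit_measure)

text \<open>An upper bound suffices for Fubini: \<open>\<bar>f\<bar> \<le> 2 * \<bar>g\<bar> - f\<close> whenever \<open>f \<le> g\<close>.\<close>

lemma torus_insert:
  fixes f :: "(nat \<Rightarrow> real) \<Rightarrow> real"
  assumes I: "finite I" "i \<notin> I"
    and f: "f \<in> borel_measurable (torus (insert i I))"
    and g: "integrable (torus I) g" and h: "integrable (torus I) h"
    and ae: "AE x in torus I. integrable unit_measure (\<lambda>y. f (x(i := y))) \<and>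
      (LINT y|unit_measure. f (x(i := y))) = h x \<and> (\<forall>y. f (x(i := y)) \<le> g x)"
  shows "integrable (torus (insert i I)) f"
    and "(LINT x|torus (insert i I). f x) = (LINT x|torus I. h x)"
proof -
  have m: "(\<lambda>x. ennreal (norm (f x))) \<in> borel_measurable (torus (insert i I))"
    using f by measurable
  have "(\<integral>\<^sup>+ x. ennreal (norm (f x)) \<partial>torus (insert i I)) =
      (\<integral>\<^sup>+ x. (\<integral>\<^sup>+ y. ennreal (norm (f (x(i := y)))) \<partial>unit_measure) \<partial>torus I)"
    by (rule unit_product.product_nn_integral_insert[OF I m])
  also have "\<dots> \<le> (\<integral>\<^sup>+ x. ennreal (norm (2 * \<bar>g x\<bar> - h x)) \<partial>torus I)"
  proof (rule nn_integral_mono_AE)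
    show "AE x in torus I. (\<integral>\<^sup>+ y. ennreal (norm (f (x(i := y)))) \<partial>unit_measure) \<le> ennreal (norm (2 * \<bar>g x\<bar> - h x))"
      using ae
    proof eventually_elim
      case (elim x)
      then have i: "integrable unit_measure (\<lambda>y. f (x(i := y)))"
        and le: "\<And>y. f (x(i := y)) \<le> g x" by auto
      have "(\<integral>\<^sup>+ y. ennreal (norm (f (x(i := y)))) \<partial>unit_measure) = ennreal (LINT y|unit_measure. norm (f (x(i := y))))"
        by (rule nn_integral_eq_integral) (use i in auto)
      also have "\<dots> \<le> ennreal (norm (2 * \<bar>g x\<bar> - h x))"
      proof (rule ennreal_leI)
        have "(LINT y|unit_measure. norm (f (x(i := y)))) \<le> (LINT y|unit_measure. 2 * \<bar>g x\<bar> - f (x(i := y)))"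
        proof (rule integral_mono)
          show "norm (f (x(i := y))) \<le> 2 * \<bar>g x\<bar> - f (x(i := y))" for y
            using le[of y] by (auto simp: abs_if)
        qed (use i in auto)
        also have "\<dots> = 2 * \<bar>g x\<bar> - h x"
          using i elim by (simp add: unit.prob_space[simplified])
        also have "\<dots> \<le> norm (2 * \<bar>g x\<bar> - h x)" by simp
        finally show "(LINT y|unit_measure. norm (f (x(i := y)))) \<le> norm (2 * \<bar>g x\<bar> - h x)" .
      qed
      finally show ?case .
    qed
  qed
  also have "\<dots> < \<infinity>"
  proof -
    have "integrable (torus I) (\<lambda>x. 2 * \<bar>g x\<bar> - h x)" using g h by auto
    then show ?thesis by (simp add: integrable_iff_bounded)
  qed
  finally show int: "integrable (torus (insert i I)) f"
    using f by (simp add: integrable_iff_bounded)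
  have mi: "(\<lambda>x. LINT y|unit_measure. f (x(i := y))) \<in> borel_measurable (torus I)"
  proof (rule unit.borel_measurable_lebesgue_integral)
    have "(\<lambda>z. (fst z)(i := snd z)) \<in> measurable (torus I \<Otimes>\<^sub>M unit_measure) (torus (insert i I))"
      using measurable_add_dim[of i I "\<lambda>_. unit_measure"] by (simp add: case_prod_unfold)
    from measurable_compose[OF this f]
    show "(\<lambda>(x, y). f (x(i := y))) \<in> borel_measurable (torus I \<Otimes>\<^sub>M unit_measure)"
      by (simp add: case_prod_unfold)
  qed
  have "(LINT x|torus (insert i I). f x) = (LINT x|torus I. (LINT y|unit_measure. f (x(i := y))))"
    by (rule unit_product.product_integral_insert[OF I int])
  also have "\<dots> = (LINT x|torus I. h x)"
    by (rule integral_cong_AE) (use ae mi h in auto)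
  finally show "(LINT x|torus (insert i I). f x) = (LINT x|torus I. h x)" .
qed

lemma torus_singleton:
  fixes f :: "real \<Rightarrow> real"
  assumes "integrable unit_measure f"
  shows "integrable (torus {i}) (\<lambda>\<theta>. f (\<theta> i))" and "(LINT \<theta>|torus {i}. f (\<theta> i)) = (LINT x|unit_measure. f x)"
proof -
  show "(LINT \<theta>|torus {i}. f (\<theta> i)) = (LINT x|unit_measure. f x)"
    using assms by (intro unit_product.product_integral_singleton) auto
  have "(\<integral>\<^sup>+ \<theta>. ennreal (norm (f (\<theta> i))) \<partial>torus {i}) = (\<integral>\<^sup>+ x. ennreal (norm (f x)) \<partial>unit_measure)"
    using assms by (intro unit_product.product_nn_integral_singleton) auto
  moreover have "(\<lambda>\<theta>. f (\<theta> i)) \<in> borel_measurable (torus {i})"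
    using assms by (intro measurable_compose[OF measurable_component_singleton]) auto
  ultimately show "integrable (torus {i}) (\<lambda>\<theta>. f (\<theta> i))"
    using assms by (auto simp: integrable_iff_bounded)
qed

text \<open>Coordinate \<open>j\<close> is integrated first, then \<open>k\<close>, then 0. The
  majorant \<open>g\<close> depends on \<open>x\<close> alone, so it passes through both inner
  integrations unchanged; \<open>A\<close> and \<open>B\<close> describe the generic angles at which
  the one-variable means are available.\<close>

lemma torus3_iterated:
  fixes F :: "real \<Rightarrow> real \<Rightarrow> real \<Rightarrow> real" and j k :: nat
  assumes jk: "{..<3} = {j, k, 0}" "j \<noteq> k" "j \<noteq> 0" "k \<noteq> 0"
    and A: "AE x in unit_measure. A x" and B: "AE z in unit_measure. B z"
    and mF: "(\<lambda>(x, z, y). F x z y) \<in> borel_measurable (borel \<Otimes>\<^sub>M borel \<Otimes>\<^sub>M borel)"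
    and mG: "(\<lambda>(x, z). G x z) \<in> borel_measurable (borel \<Otimes>\<^sub>M borel)"
    and g: "integrable unit_measure g" and H: "integrable unit_measure H"
    and bound: "\<And>x z y. A x \<Longrightarrow> F x z y \<le> g x"
    and inner: "\<And>x z. A x \<Longrightarrow> B z \<Longrightarrow> integrable unit_measure (F x z) \<and> (LINT y|unit_measure. F x z y) = G x z"
    and mid: "\<And>x. A x \<Longrightarrow> integrable unit_measure (G x) \<and> (LINT z|unit_measure. G x z) = H x"
  shows "(LINT \<theta>|torus {..<3}. F (\<theta> 0) (\<theta> k) (\<theta> j)) = (LINT x|unit_measure. H x)"
proof -
  have aeA: "AE \<theta> in torus {0}. A (\<theta> 0)" "AE \<theta> in torus {k, 0}. A (\<theta> 0)"
    and aeB: "AE \<theta> in torus {k, 0}. B (\<theta> k)"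
    by (rule AE_torus_component; use A B in simp)+
  have meas: "(\<lambda>\<theta>. F (\<theta> 0) (\<theta> k) (\<theta> j)) \<in> borel_measurable (torus {j, k, 0})"
  proof -
    have "(\<lambda>\<theta>. (\<theta> 0, \<theta> k, \<theta> j)) \<in> measurable (torus {j, k, 0}) (borel \<Otimes>\<^sub>M borel \<Otimes>\<^sub>M borel)"
      by (intro measurable_Pair measurable_torus_component) auto
    from measurable_compose[OF this mF] show ?thesis by simp
  qed
  have meas2: "(\<lambda>\<theta>. G (\<theta> 0) (\<theta> k)) \<in> borel_measurable (torus {k, 0})"
  proof -
    have "(\<lambda>\<theta>. (\<theta> 0, \<theta> k)) \<in> measurable (torus {k, 0}) (borel \<Otimes>\<^sub>M borel)"
      by (intro measurable_Pair measurable_torus_component) auto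
    from measurable_compose[OF this mG] show ?thesis by simp
  qed
  have Gle: "G x z \<le> g x" if "A x" "B z" for x z
  proof -
    have "(LINT y|unit_measure. F x z y) \<le> (LINT y|unit_measure. g x)"
      by (rule integral_mono) (use inner bound that in auto)
    then show ?thesis using inner[OF that] by (simp add: unit.prob_space[simplified])
  qed
  \<comment> \<open>For generic x, the bound of \<open>G x z\<close> by \<open>g x\<close> is known
    only for generic z, whereas \<open>torus_insert\<close> asks for it everywhere; the truncation
    repairs this and alters \<open>G x\<close> only on a null set.\<close>
  define G' where "G' x z = (if G x z \<le> g x then G x z else g x)" for x z
  have G'_le: "G' x z \<le> g x" for x z by (simp add: G'_def)
  have mG': "integrable unit_measure (G' x) \<and> (LINT z|unit_measure. G' x z) = H x" if "A x" for x
  proof -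
    have e: "G' x = (\<lambda>z. min (G x z) (g x))" by (auto simp: G'_def fun_eq_iff)
    have i: "integrable unit_measure (G' x)" unfolding e using mid[OF that] by auto
    have "(LINT z|unit_measure. G' x z) = (LINT z|unit_measure. G x z)"
    proof (rule integral_cong_AE)
      show "AE z in unit_measure. G' x z = G x z"
        using B by eventually_elim (use Gle[OF that] in \<open>auto simp: G'_def\<close>)
    qed (use i mid[OF that] in auto)
    then show ?thesis using i mid[OF that] by simp
  qed
  have meas2': "(\<lambda>\<theta>. G' (\<theta> 0) (\<theta> k)) \<in> borel_measurable (torus {k, 0})"
  proof -
    have "(\<lambda>\<theta>. g (\<theta> 0)) \<in> borel_measurable (torus {k, 0})"
      using g by (intro measurable_torus_compose) auto
    then show ?thesis unfolding G'_def using meas2 by measurable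
  qed
  have mid2: "integrable (torus {k, 0}) (\<lambda>\<theta>. G' (\<theta> 0) (\<theta> k))"
       "(LINT \<theta>|torus {k, 0}. G' (\<theta> 0) (\<theta> k)) = (LINT \<theta>|torus {0}. H (\<theta> 0))"
  proof -
    have ae: "AE x in torus {0}. integrable unit_measure (\<lambda>y. G' ((x(k := y)) 0) ((x(k := y)) k)) \<and>
      (LINT y|unit_measure. G' ((x(k := y)) 0) ((x(k := y)) k)) = H (x 0) \<and>
      (\<forall>y. G' ((x(k := y)) 0) ((x(k := y)) k) \<le> g (x 0))"
      using aeA(1)
    proof eventually_elim
      case (elim x)
      show ?case using mG'[OF elim] jk(4) G'_le by simp
    qed
    note * = torus_insert[where I = "{0}" and i = k, OF _ _ meas2' torus_singleton(1)[OF g] torus_singleton(1)[OF H] ae]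
    show "integrable (torus {k, 0}) (\<lambda>\<theta>. G' (\<theta> 0) (\<theta> k))"
       "(LINT \<theta>|torus {k, 0}. G' (\<theta> 0) (\<theta> k)) = (LINT \<theta>|torus {0}. H (\<theta> 0))"
      using * jk(2-4) by auto
  qed
  have g2: "integrable (torus {k, 0}) (\<lambda>\<theta>. g (\<theta> 0))"
  proof (rule torus_insert(1)[where g = "\<lambda>\<theta>. g (\<theta> 0)" and h = "\<lambda>\<theta>. g (\<theta> 0)"])
    show "(\<lambda>\<theta>. g (\<theta> 0)) \<in> borel_measurable (torus {k, 0})"
      using g by (intro measurable_torus_compose) auto
  qed (use jk(2-4) torus_singleton(1)[OF g] in \<open>auto simp: unit.prob_space[simplified]\<close>)
  have ae3: "AE x in torus {k, 0}. integrable unit_measure (\<lambda>y. F ((x(j := y)) 0) ((x(j := y)) k) ((x(j := y)) j)) \<and>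
      (LINT y|unit_measure. F ((x(j := y)) 0) ((x(j := y)) k) ((x(j := y)) j)) = G' (x 0) (x k) \<and>
      (\<forall>y. F ((x(j := y)) 0) ((x(j := y)) k) ((x(j := y)) j) \<le> g (x 0))"
    using aeA(2) aeB
  proof eventually_elim
    case (elim x)
    moreover have "G' (x 0) (x k) = G (x 0) (x k)" using Gle[OF elim] by (simp add: G'_def)
    ultimately show ?case using inner[OF elim] bound[OF elim(1)] jk(2-4) by simp
  qed
  have "(LINT \<theta>|torus (insert j {k, 0}). F (\<theta> 0) (\<theta> k) (\<theta> j)) = (LINT \<theta>|torus {k, 0}. G' (\<theta> 0) (\<theta> k))"
    by (rule torus_insert(2)[OF _ _ meas g2 mid2(1) ae3]) (use jk(2-4) in auto)
  also have "\<dots> = (LINT x|unit_measure. H x)"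
    using mid2(2) torus_singleton(2)[OF H] by simp
  finally show ?thesis unfolding jk .
qed

section \<open>Passage from the complex variables to angles\<close>

lemma mahler3_iterated:
  fixes P :: "complex \<Rightarrow> complex \<Rightarrow> complex \<Rightarrow> complex" and j k :: nat
  assumes "\<And>\<theta>. ln (cmod (P (unit_circle (\<theta> 0)) (unit_circle (\<theta> 1)) (unit_circle (\<theta> 2)))) = F (\<theta> 0) (\<theta> k) (\<theta> j)"
    and "(LINT \<theta>|torus {..<3}. F (\<theta> 0) (\<theta> k) (\<theta> j)) = I"
  shows "mahler3 P = I"
  using assms unfolding mahler3_def mahler_measure_def unit_measure_def[symmetric] unit_circle_def[symmetric]
  by simp

lemma mahler1_eq: 
  assumes "integrable unit_measure F" "\<And>\<theta>. ln (cmod (P (unit_circle \<theta>))) = F \<theta>"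
  shows "mahler1 P = (LINT x|unit_measure. F x)"
proof -
  have "{..<1} = {0::nat}" by auto
  then show ?thesis
    using torus_singleton(2)[OF assms(1), of 0] assms(2)
    unfolding mahler1_def mahler_measure_def unit_measure_def[symmetric] unit_circle_def[symmetric]
    by simp
qed

text \<open>Numerator and denominator share the factor e^(i pi theta), which leaves -2 i sin over 2
  cos. The equation persists at x = -1, where both sides are 0 by the convention for
  division.\<close>

lemma unit_circle_cayley:
  "(1 - unit_circle \<theta>) / (1 + unit_circle \<theta>) = Complex 0 (- tan (pi * \<theta>))"
proof -
  define a where "a = pi * \<theta>"
  have u: "unit_circle \<theta> = cis a * cis a"
    by (simp add: unit_circle_eq_cis cis_mult a_def mult.assoc)
  have c: "cis a * cis (- a) = 1" by (simp add: cis_mult)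
  have 1: "1 + unit_circle \<theta> = cis a * (cis (- a) + cis a)"
    and 2: "1 - unit_circle \<theta> = cis a * (cis (- a) - cis a)"
    unfolding u using c by (simp_all add: algebra_simps)
  have 3: "cis (- a) + cis a = of_real (2 * cos a)" "cis (- a) - cis a = Complex 0 (- 2 * sin a)"
    by (simp_all add: complex_eq_iff)
  show ?thesis
    unfolding 1 2 3 using cis_neq_zero[of a]
    by (simp add: tan_def a_def[symmetric] complex_eq_iff Re_divide_of_real Im_divide_of_real)
qed

subsection \<open>The four Mahler measures\<close>

lemma AE_sin_nonzero: "c \<noteq> 0 \<Longrightarrow> AE x in unit_measure. sin (c * x) \<noteq> 0"
  using countable_sin_zeros[of c] by (intro AE_unit_measure_countable) simp

lemma AE_cos_nonzero: "c \<noteq> 0 \<Longrightarrow> AE x in unit_measure. cos (c * x) \<noteq> 0"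
  using countable_cos_zeros[of c] by (intro AE_unit_measure_countable) simp

text \<open>As \<open>tan\<close> is 0 at its poles, this condition excludes the poles together with
  the zeros.\<close>

lemma AE_tan_nonzero:
  assumes "c \<noteq> 0"
  shows "AE x in unit_measure. tan (c * x) \<noteq> 0"
  using AE_sin_nonzero[OF assms] AE_cos_nonzero[OF assms]
  by eventually_elim (simp add: tan_def)

text \<open>Supplies the majorant in x alone for identities (1), (3) and (4). The degree 4 comes
  from (4), whose modulus is at most 24 (1 + s^2)^2; the constant 36 leaves room. For
  \<open>c = 0\<close> the convention \<open>ln 0 = 0\<close> is harmless because the bound is
  nonnegative.\<close>

lemma ln_le_weight:
  fixes c r :: real
  assumes "0 \<le> c" "0 \<le> r" "c \<le> 36 * (1 + r) ^ 4"
  shows "ln c \<le> ln 36 + 4 * ln (1 + r)"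
proof (cases "c = 0")
  case True
  have "0 \<le> ln (36 :: real)" "0 \<le> ln (1 + r)" using assms by auto
  then show ?thesis using True by simp
next
  case False
  then have "ln c \<le> ln (36 * (1 + r) ^ 4)"
    using assms by (intro ln_le_cancel_iff[THEN iffD2]) auto
  also have "\<dots> = ln 36 + ln ((1 + r) ^ 4)"
    using assms by (intro ln_mult_pos) auto
  also have "ln ((1 + r) ^ 4) = 4 * ln (1 + r)"
    using assms by (subst ln_realpow) auto
  finally show ?thesis .
qed

lemma integrable_weight:
  assumes "0 \<le> B"
  shows "integrable unit_measure (\<lambda>x. ln 36 + 4 * ln (1 + B * \<bar>tan (pi * x)\<bar>))"
  using integrable_ln_tan[OF assms, of 1] by simp

lemma integrable_ln_one_plus_square_tan:
  assumes "0 \<le> B"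
  shows "integrable unit_measure (\<lambda>x. ln (1 + (B * tan (pi * x))\<^sup>2))"
proof (rule Bochner_Integration.integrable_bound[OF integrable_weight[OF assms]])
  show "(\<lambda>x. ln (1 + (B * tan (pi * x))\<^sup>2)) \<in> borel_measurable unit_measure"
    unfolding tan_def by (rule measurable_unit_measure) measurable
  show "AE x in unit_measure. norm (ln (1 + (B * tan (pi * x))\<^sup>2)) \<le> norm (ln 36 + 4 * ln (1 + B * \<bar>tan (pi * x)\<bar>))"
  proof (rule AE_I2)
    fix x
    define r where "r = B * \<bar>tan (pi * x)\<bar>"
    have r: "0 \<le> r" "(B * tan (pi * x))\<^sup>2 = r\<^sup>2" using assms by (auto simp: r_def power_mult_distrib)
    have "1 + r\<^sup>2 \<le> 36 * (1 + r) ^ 4"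
      using r by (simp add: power_numeral_reduce algebra_simps)
    then have "ln (1 + r\<^sup>2) \<le> ln 36 + 4 * ln (1 + r)"
      using r by (intro ln_le_weight) auto
    moreover have "0 \<le> ln (1 + r\<^sup>2)" by simp
    ultimately show "norm (ln (1 + (B * tan (pi * x))\<^sup>2)) \<le> norm (ln 36 + 4 * ln (1 + B * \<bar>tan (pi * x)\<bar>))"
      unfolding r(2) r_def[symmetric] by simp
  qed
qed

text \<open>Factoring out |T| and writing A / |T| = sinh w reduces the claim to
  \<open>jensen_sinh\<close>; the square root comes from the logarithmic form of arsinh.\<close>

lemma jensen_of_real_sin:
  fixes A T :: real
  assumes "0 < A" "T \<noteq> 0"
  shows "integrable unit_measure (\<lambda>\<theta>. ln (cmod (Complex A (T * sin (2 * pi * \<theta>)))))"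
    and "(LINT \<theta>|unit_measure. ln (cmod (Complex A (T * sin (2 * pi * \<theta>))))) = ln ((A + sqrt (A\<^sup>2 + T\<^sup>2)) / 2)"
proof -
  define w where "w = arsinh (A / \<bar>T\<bar>)"
  have w: "sinh w = A / \<bar>T\<bar>" by (simp add: w_def)
  have "w > 0" using assms by (simp add: w_def)
  have eq: "ln (cmod (Complex A (T * sin (2 * pi * \<theta>)))) = ln \<bar>T\<bar> + ln (cmod (Complex (sinh w) (sin (2 * pi * \<theta>))))" for \<theta>
  proof -
    have "cmod (Complex A (T * sin (2 * pi * \<theta>))) = \<bar>T\<bar> * cmod (Complex (sinh w) (sin (2 * pi * \<theta>)))"
      unfolding w cmod_def complex.sel using assms
      by (intro real_sqrt_unique) (auto simp: power_mult_distrib power_divide field_simps)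
    moreover have "cmod (Complex (sinh w) (sin (2 * pi * \<theta>))) > 0"
      using assms by (simp add: complex_eq_iff w)
    ultimately show ?thesis using assms by (simp add: ln_mult_pos)
  qed
  show "integrable unit_measure (\<lambda>\<theta>. ln (cmod (Complex A (T * sin (2 * pi * \<theta>)))))"
    unfolding eq using jensen_sinh(1)[of w] \<open>w > 0\<close> by auto
  have "(LINT \<theta>|unit_measure. ln (cmod (Complex A (T * sin (2 * pi * \<theta>))))) = ln \<bar>T\<bar> + (w - ln 2)"
    unfolding eq using jensen_sinh[of w] \<open>w > 0\<close> by (simp add: unit.prob_space[simplified])
  also have "w = ln (A / \<bar>T\<bar> + sqrt ((A / \<bar>T\<bar>)\<^sup>2 + 1))"
    by (simp add: w_def arsinh_real_def)
  also have "(A / \<bar>T\<bar>)\<^sup>2 + 1 = (A\<^sup>2 + T\<^sup>2) / \<bar>T\<bar>\<^sup>2"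
    using assms by (simp add: field_simps)
  also have "sqrt ((A\<^sup>2 + T\<^sup>2) / \<bar>T\<bar>\<^sup>2) = sqrt (A\<^sup>2 + T\<^sup>2) / \<bar>T\<bar>"
    by (simp add: real_sqrt_divide)
  also have "A / \<bar>T\<bar> + sqrt (A\<^sup>2 + T\<^sup>2) / \<bar>T\<bar> = (A + sqrt (A\<^sup>2 + T\<^sup>2)) / \<bar>T\<bar>"
    by (simp add: add_divide_distrib)
  also have "ln \<bar>T\<bar> + (ln ((A + sqrt (A\<^sup>2 + T\<^sup>2)) / \<bar>T\<bar>) - ln 2) = ln ((A + sqrt (A\<^sup>2 + T\<^sup>2)) / 2)"
  proof -
    have "A + sqrt (A\<^sup>2 + T\<^sup>2) > 0" using assms by (intro add_pos_nonneg) auto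
    then show ?thesis using assms by (simp add: ln_div)
  qed
  finally show "(LINT \<theta>|unit_measure. ln (cmod (Complex A (T * sin (2 * pi * \<theta>))))) = ln ((A + sqrt (A\<^sup>2 + T\<^sup>2)) / 2)" .
qed

text \<open>Both sides are the mean of \<open>ln \<bar>1 + r\<^sup>2 + 2 \<i> r tan (2 \<pi> t) sin (2 \<pi> b)\<bar>\<close> over \<open>t\<close> and \<open>b\<close>,
  integrated in either order.\<close>

lemma ln_ellipse_sum_mean:
  assumes "0 < r"
  defines "C \<equiv> \<lambda>z. (1 + r\<^sup>2) * \<bar>cos (2 * pi * z)\<bar>"
  defines "D \<equiv> \<lambda>z. cmod (Complex ((1 + r\<^sup>2) * cos (2 * pi * z)) (2 * r * sin (2 * pi * z)))"
  shows "integrable unit_measure (\<lambda>z. ln (D z + C z))"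
    and "(LINT z|unit_measure. ln (D z + C z)) = 4 / pi * ti2 r"
proof -
  interpret pair_sigma_finite unit_measure unit_measure by standard
  define A where "A = 1 + r\<^sup>2"
  have A: "1 \<le> A" by (simp add: A_def)
  define k where "k t b = ln (cmod (Complex A (2 * r * (sin (2 * pi * t) / cos (2 * pi * t)) * sin (2 * pi * b))))" for t b
  \<comment> \<open>The mean of \<open>k t\<close> over b: for T = 2 r tan (2 pi t), D = |cos| sqrt
    (A^2 + T^2) and C = |cos| A, so this is ln ((A + sqrt (A^2 + T^2)) / 2).\<close>
  define m where "m t = ln (D t + C t) - ln \<bar>cos (2 * pi * t)\<bar> - ln 2" for t
  \<comment> \<open>Nonnegativity, from A \<ge> 1, permits Tonelli; the finite value of the other
    iterated integral then yields integrability of \<open>m\<close>.\<close>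
  have k0: "0 \<le> k t b" for t b
  proof -
    have "\<bar>Re (Complex A x)\<bar> \<le> cmod (Complex A x)" for x by (rule abs_Re_le_cmod)
    then show ?thesis using A unfolding k_def by (intro ln_ge_zero) (simp add: order_trans)
  qed
  have km: "(\<lambda>(t, b). ennreal (k t b)) \<in> borel_measurable (unit_measure \<Otimes>\<^sub>M unit_measure)"
  proof -
    have "(\<lambda>(t, b). ennreal (k t b)) \<in> borel_measurable (borel \<Otimes>\<^sub>M borel)"
      unfolding k_def cmod_def complex.sel by measurable
    moreover have "(\<lambda>x. (fst x, snd x)) \<in> measurable (unit_measure \<Otimes>\<^sub>M unit_measure) (borel \<Otimes>\<^sub>M borel)"
      by (intro measurable_Pair measurable_compose[OF measurable_fst measurable_unit_measure[OF measurable_ident_sets[OF refl]]]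
          measurable_compose[OF measurable_snd measurable_unit_measure[OF measurable_ident_sets[OF refl]]])
    ultimately show ?thesis using measurable_compose by fastforce
  qed
  have inner1: "integrable unit_measure (\<lambda>t. k t b) \<and> (LINT t|unit_measure. k t b) = ln (1 + r\<^sup>2 + 2 * r * \<bar>sin (2 * pi * b)\<bar>)" for b
    using jensen_tan[of A 2 "2 * r * sin (2 * pi * b)"] A \<open>0 < r\<close>
    by (simp add: k_def tan_def abs_mult mult_ac flip: A_def)
  have inner2: "integrable unit_measure (k t) \<and> (LINT b|unit_measure. k t b) = m t"
    if nz: "cos (2 * pi * t) \<noteq> 0" "sin (2 * pi * t) \<noteq> 0" for t
  proof -
    define c where "c = \<bar>cos (2 * pi * t)\<bar>"
    define T where "T = 2 * r * (sin (2 * pi * t) / cos (2 * pi * t))"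
    have T: "T \<noteq> 0" using nz assms by (simp add: T_def)
    have c: "c > 0" using nz by (simp add: c_def)
    have "D t = c * sqrt (A\<^sup>2 + T\<^sup>2)"
    proof -
      have "(A * cos (2 * pi * t))\<^sup>2 + (2 * r * sin (2 * pi * t))\<^sup>2 = c\<^sup>2 * (A\<^sup>2 + T\<^sup>2)"
        using nz unfolding c_def T_def by (simp add: power_mult_distrib power_divide field_simps)
      then show ?thesis using c unfolding D_def cmod_def complex.sel A_def[symmetric]
        by (simp add: real_sqrt_mult)
    qed
    moreover have "C t = c * A" by (simp add: C_def c_def A_def)
    ultimately have e: "D t + C t = c * (A + sqrt (A\<^sup>2 + T\<^sup>2))" by (simp add: algebra_simps)
    have p: "A + sqrt (A\<^sup>2 + T\<^sup>2) > 0" using A by (intro add_pos_nonneg) auto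
    have "m t = ln ((A + sqrt (A\<^sup>2 + T\<^sup>2)) / 2)"
      unfolding m_def e c_def[symmetric] using c p by (simp add: ln_mult_pos ln_div)
    then show ?thesis
      using jensen_of_real_sin[of A T] A T unfolding k_def T_def by simp
  qed
  have ae: "AE t in unit_measure. cos (2 * pi * t) \<noteq> 0 \<and> sin (2 * pi * t) \<noteq> 0"
    using AE_cos_nonzero[of "2 * pi"] AE_sin_nonzero[of "2 * pi"] by simp
  have "(\<integral>\<^sup>+ t. ennreal (m t) \<partial>unit_measure) = (\<integral>\<^sup>+ t. \<integral>\<^sup>+ b. ennreal (k t b) \<partial>unit_measure \<partial>unit_measure)"
  proof (rule nn_integral_cong_AE)
    show "AE t in unit_measure. ennreal (m t) = (\<integral>\<^sup>+ b. ennreal (k t b) \<partial>unit_measure)"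
      using ae by eventually_elim (use inner2 k0 in \<open>simp add: nn_integral_eq_integral\<close>)
  qed
  also have "\<dots> = (\<integral>\<^sup>+ b. \<integral>\<^sup>+ t. ennreal (k t b) \<partial>unit_measure \<partial>unit_measure)"
    using Fubini'[OF km] by simp
  also have "\<dots> = (\<integral>\<^sup>+ b. ennreal (ln (1 + r\<^sup>2 + 2 * r * \<bar>sin (2 * pi * b)\<bar>)) \<partial>unit_measure)"
    by (rule nn_integral_cong) (use inner1 k0 in \<open>simp add: nn_integral_eq_integral\<close>)
  also have "\<dots> = ennreal (4 / pi * ti2 r)"
  proof -
    have "0 \<le> ln (1 + r\<^sup>2 + 2 * r * \<bar>sin (2 * pi * b)\<bar>)" for b
      using assms by (intro ln_ge_zero) (simp add: add_nonneg_nonneg)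
    then show ?thesis
      using ln_sin_mean[of r] assms by (simp add: nn_integral_eq_integral)
  qed
  finally have nn: "(\<integral>\<^sup>+ t. ennreal (m t) \<partial>unit_measure) = ennreal (4 / pi * ti2 r)" .
  have m0: "AE t in unit_measure. 0 \<le> m t"
    using ae
  proof eventually_elim
    case (elim t)
    have "0 \<le> (LINT b|unit_measure. k t b)" by (intro integral_nonneg_AE AE_I2 k0)
    then show ?case using inner2 elim by simp
  qed
  have mm: "m \<in> borel_measurable unit_measure"
    unfolding m_def D_def C_def cmod_def complex.sel by (rule measurable_unit_measure) measurable
  have mi: "integrable unit_measure m"
    by (rule integrableI_nn_integral_finite[OF mm m0 nn])
  have mv: "(LINT t|unit_measure. m t) = 4 / pi * ti2 r"
    using integral_eq_nn_integral[OF mm m0] nn ti2_nonneg[of r] by simp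
  have eq: "(\<lambda>z. ln (D z + C z)) = (\<lambda>z. m z + ln \<bar>cos (2 * pi * z)\<bar> + ln 2)"
    by (simp add: m_def fun_eq_iff)
  show "integrable unit_measure (\<lambda>z. ln (D z + C z))"
    unfolding eq using mi jensen_cos(1)[of 2] by simp
  show "(LINT z|unit_measure. ln (D z + C z)) = 4 / pi * ti2 r"
    unfolding eq using mi jensen_cos[of 2] mv by (simp add: unit.prob_space[simplified])
qed

lemma integrable_mult_ti2_tan:
  assumes "0 \<le> B"
  shows "integrable unit_measure (\<lambda>x. c * ti2 (B * \<bar>tan (pi * x)\<bar>))"
  using integrable_ti2_tan[OF assms] by simp

lemma ti2_mean_rearrange:
  fixes a T :: real
  shows "2 / pi * (2 * a - 4 / pi * T) = 4 / pi * a - 8 / pi\<^sup>2 * T"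
  by (simp add: right_diff_distrib power2_eq_square)

lemma lessThan_3: "{..<3::nat} = {1, 2, 0}" "{..<3::nat} = {2, 1, 0}"
  by auto

section \<open>Evaluation of the four three-variable integrals\<close>

text \<open>On the torus the polynomial is (1 + s^2) + (y - i s)^2 z, and |y - i s|^2 = 1 + s^2 - 2
  s sin (2 pi y). Jensen in z selects the larger of the two moduli, which differ as soon as s and
  the sine are nonzero.\<close>

lemma mahler_identity_1:
  fixes v :: real
  assumes "v > 0"
  shows "mahler3 (\<lambda>x y z. 1 - of_real v ^ 4 * ((1 - x) / (1 + x)) ^ 2
          + (y + of_real v ^ 2 * ((1 - x) / (1 + x))) ^ 2 * z)
     = 4 / pi * (LBINT u:{0..v}. arctan u / u) - 8 / pi ^ 2 * T_arctan v (1 / v)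
       + 1 / 2 * mahler1 (\<lambda>x. 1 - of_real v ^ 4 * ((1 - x) / (1 + x)) ^ 2)"
proof -
  define s where "s x = v\<^sup>2 * tan (pi * x)" for x
  define H where "H x = ln (1 + (s x)\<^sup>2) / 2 + 2 / pi * ti2 (v\<^sup>2 * \<bar>tan (pi * x)\<bar>)" for x
  define G where "G x y = ln (max (1 + (s x)\<^sup>2) (1 + (s x)\<^sup>2 - 2 * s x * sin (2 * pi * y)))" for x y
  define F where "F x y z = ln (cmod (of_real (1 + (s x)\<^sup>2) + (unit_circle y + Complex 0 (- s x))\<^sup>2 * unit_circle z))" for x y z
  have q: "1 - of_real v ^ 4 * ((1 - unit_circle x) / (1 + unit_circle x)) ^ 2 = of_real (1 + (s x)\<^sup>2)" for x
    unfolding unit_circle_cayley s_def by (simp add: complex_eq_iff power2_eq_square power_numeral_reduce)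
  have l: "of_real v ^ 2 * ((1 - unit_circle x) / (1 + unit_circle x)) = Complex 0 (- s x)" for x
    unfolding unit_circle_cayley s_def by (simp add: complex_eq_iff flip: of_real_power)
  have i1: "integrable unit_measure (\<lambda>x. ln (1 + (s x)\<^sup>2))"
    unfolding s_def by (rule integrable_ln_one_plus_square_tan) simp
  have i2: "integrable unit_measure (\<lambda>x. 2 / pi * ti2 (v\<^sup>2 * \<bar>tan (pi * x)\<bar>))"
    by (rule integrable_mult_ti2_tan) simp
  have nb: "(cmod (unit_circle y + Complex 0 (- s x)))\<^sup>2 = 1 + (s x)\<^sup>2 - 2 * s x * sin (2 * pi * y)" for x y
    unfolding unit_circle_eq_cis cmod_power2 using sin_cos_squared_add[of "2 * pi * y"]
    by (simp add: power2_eq_square algebra_simps)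
  have "mahler3 (\<lambda>x y z. 1 - of_real v ^ 4 * ((1 - x) / (1 + x)) ^ 2
          + (y + of_real v ^ 2 * ((1 - x) / (1 + x))) ^ 2 * z) = (LINT x|unit_measure. H x)"
  proof (rule mahler3_iterated)
    show "ln (cmod (1 - of_real v ^ 4 * ((1 - unit_circle (\<theta> 0)) / (1 + unit_circle (\<theta> 0))) ^ 2
          + (unit_circle (\<theta> 1) + of_real v ^ 2 * ((1 - unit_circle (\<theta> 0)) / (1 + unit_circle (\<theta> 0)))) ^ 2 * unit_circle (\<theta> 2)))
        = F (\<theta> 0) (\<theta> 1) (\<theta> 2)" for \<theta>
      unfolding q l F_def ..
    show "(LINT \<theta>|torus {..<3}. F (\<theta> 0) (\<theta> 1) (\<theta> 2)) = (LINT x|unit_measure. H x)"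
    proof (rule torus3_iterated[where A = "\<lambda>x. tan (pi * x) \<noteq> 0" and B = "\<lambda>y. sin (2 * pi * y) \<noteq> 0" and G = G])
      show "(\<lambda>(x, y, z). F x y z) \<in> borel_measurable (borel \<Otimes>\<^sub>M borel \<Otimes>\<^sub>M borel)"
      proof -
        have c: "Complex 0 (- s x) = - (\<i> * of_real (s x))" for x by (simp add: complex_eq_iff)
        show ?thesis unfolding F_def c unfolding s_def tan_def by measurable
      qed
      show "(\<lambda>(x, y). G x y) \<in> borel_measurable (borel \<Otimes>\<^sub>M borel)"
        unfolding G_def s_def tan_def by measurable
      show "integrable unit_measure (\<lambda>x. ln 36 + 4 * ln (1 + v\<^sup>2 * \<bar>tan (pi * x)\<bar>))"
        by (rule integrable_weight) simp
      show "integrable unit_measure H"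
        unfolding H_def using i1 i2 by auto
      fix x y
      define r where "r = v\<^sup>2 * \<bar>tan (pi * x)\<bar>"
      have r: "r = \<bar>s x\<bar>" "0 \<le> r" by (auto simp: r_def s_def abs_mult)
      have r2: "(s x)\<^sup>2 = r\<^sup>2" using r by simp
      show "F x y z \<le> ln 36 + 4 * ln (1 + v\<^sup>2 * \<bar>tan (pi * x)\<bar>)" for z
        unfolding F_def r_def[symmetric]
      proof (rule ln_le_weight)
        have "cmod (of_real (1 + (s x)\<^sup>2) + (unit_circle y + Complex 0 (- s x))\<^sup>2 * unit_circle z)
          \<le> cmod (of_real (1 + (s x)\<^sup>2)) + cmod ((unit_circle y + Complex 0 (- s x))\<^sup>2 * unit_circle z)"
          by (rule norm_triangle_ineq)
        also have "\<dots> = (1 + r\<^sup>2) + (cmod (unit_circle y + Complex 0 (- s x)))\<^sup>2"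
          unfolding norm_mult norm_power norm_unit_circle norm_of_real r2 by simp
        also have "cmod (unit_circle y + Complex 0 (- s x)) \<le> 1 + r"
        proof -
          have "cmod (Complex 0 (- s x)) = r" using r by (simp add: cmod_def)
          then show ?thesis using norm_triangle_ineq[of "unit_circle y" "Complex 0 (- s x)"] by simp
        qed
        then have "(1 + r\<^sup>2) + (cmod (unit_circle y + Complex 0 (- s x)))\<^sup>2 \<le> (1 + r\<^sup>2) + (1 + r)\<^sup>2"
          by (intro add_left_mono power_mono) auto
        also have "\<dots> \<le> 36 * (1 + r) ^ 4"
          using r(2) by (simp add: power_numeral_reduce algebra_simps)
        finally show "cmod (of_real (1 + (s x)\<^sup>2) + (unit_circle y + Complex 0 (- s x))\<^sup>2 * unit_circle z) \<le> 36 * (1 + r) ^ 4" .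
      qed (use r in auto)
      assume A: "tan (pi * x) \<noteq> 0"
      then have s: "s x \<noteq> 0" using assms by (simp add: s_def)
      show "integrable unit_measure (F x y) \<and> (LINT z|unit_measure. F x y z) = G x y" if "sin (2 * pi * y) \<noteq> 0"
      proof -
        have "cmod (of_real (1 + (s x)\<^sup>2)) = 1 + (s x)\<^sup>2" unfolding norm_of_real by simp
        moreover have "cmod ((unit_circle y + Complex 0 (- s x))\<^sup>2) = 1 + (s x)\<^sup>2 - 2 * s x * sin (2 * pi * y)"
          unfolding norm_power by (rule nb)
        ultimately show ?thesis
          using jensen_linear[of "of_real (1 + (s x)\<^sup>2)" "(unit_circle y + Complex 0 (- s x))\<^sup>2" 1] s that
          unfolding F_def G_def by simp
      qed
      define L where "L y = ln (1 + r\<^sup>2 + 2 * r * \<bar>sin (2 * pi * y)\<bar>)" for y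
      have L: "integrable unit_measure L" "(LINT y|unit_measure. L y) = 4 / pi * ti2 r"
        unfolding L_def using ln_sin_mean[of r] r by auto
      \<comment> \<open>Under y -> 1 - y the sine changes sign, so one maximum is 1 + s^2 and the
        other 1 + s^2 + 2 |s sin|. Adding the two values removes the maximum; the term ln (1 + s^2),
        halved, becomes the one-variable Mahler measure.\<close>
      have pair: "G x y + G x (1 - y) = ln (1 + r\<^sup>2) + L y" for y
      proof -
        have sn: "sin (2 * pi * (1 - y)) = - sin (2 * pi * y)" by (simp add: right_diff_distrib sin_diff)
        have "2 * r * \<bar>sin (2 * pi * y)\<bar> = \<bar>2 * s x * sin (2 * pi * y)\<bar>"
          by (simp add: r(1) abs_mult)
        then show ?thesis unfolding G_def L_def sn r2 by (auto simp: max_def abs_if)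
      qed
      have iG: "integrable unit_measure (G x)"
      proof (rule Bochner_Integration.integrable_bound[OF L(1)])
        show "G x \<in> borel_measurable unit_measure"
          unfolding G_def by (rule measurable_unit_measure) measurable
        have "norm (G x y) \<le> norm (L y)" for y
        proof -
          have "0 \<le> G x y'" for y' unfolding G_def by (intro ln_ge_zero) (simp add: le_max_iff_disj)
          moreover have "G x y' \<le> L y'" for y'
          proof -
            have "- (2 * s x * sin (2 * pi * y')) \<le> 2 * r * \<bar>sin (2 * pi * y')\<bar>" "0 \<le> 2 * r * \<bar>sin (2 * pi * y')\<bar>"
              using abs_ge_minus_self[of "2 * s x * sin (2 * pi * y')"] by (simp_all add: r(1) abs_mult)
            then show ?thesis unfolding G_def L_def r2
              by (intro ln_le_cancel_iff[THEN iffD2]) (auto simp: add_pos_nonneg less_max_iff_disj)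
          qed
          ultimately show ?thesis by (smt (verit) real_norm_def)
        qed
        then show "AE y in unit_measure. norm (G x y) \<le> norm (L y)" by simp
      qed
      have iG': "integrable unit_measure (\<lambda>y. G x (1 - y))"
      proof -
        have "(\<lambda>y. G x (1 - y)) = (\<lambda>y. ln (1 + r\<^sup>2) + L y - G x y)"
          using pair by (auto simp: fun_eq_iff algebra_simps)
        then show ?thesis using L(1) iG by simp
      qed
      have "2 * (LINT y|unit_measure. G x y) = (LINT y|unit_measure. G x y) + (LINT y|unit_measure. G x (1 - y))"
        by (simp add: integral_unit_measure_reflect)
      also have "\<dots> = (LINT y|unit_measure. ln (1 + r\<^sup>2) + L y)"
        unfolding pair[symmetric] using iG iG' by simp
      also have "\<dots> = 2 * H x"
        using L by (simp add: H_def r2 r_def[symmetric] unit.prob_space[simplified])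
      finally show "integrable unit_measure (G x) \<and> (LINT y|unit_measure. G x y) = H x"
        using iG by simp
    qed (use lessThan_3 AE_tan_nonzero[of pi] AE_sin_nonzero[of "2 * pi"] in auto)
  qed
  also have "\<dots> = (LINT x|unit_measure. ln (1 + (s x)\<^sup>2)) / 2 + 2 / pi * (LINT x|unit_measure. ti2 (v\<^sup>2 * \<bar>tan (pi * x)\<bar>))"
    unfolding H_def using i1 i2 by simp
  also have "(LINT x|unit_measure. ln (1 + (s x)\<^sup>2)) = mahler1 (\<lambda>x. 1 - of_real v ^ 4 * ((1 - x) / (1 + x)) ^ 2)"
  proof (rule mahler1_eq[symmetric, OF i1])
    show "ln (cmod (1 - of_real v ^ 4 * ((1 - unit_circle x) / (1 + unit_circle x)) ^ 2)) = ln (1 + (s x)\<^sup>2)" for x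
      unfolding q norm_of_real by simp
  qed
  finally show ?thesis
    unfolding ti2_tan_mean[OF assms] ti2_def[symmetric] ti2_mean_rearrange by simp
qed

text \<open>The polynomial becomes 1 + s^2 - 2 i s sin (2 pi z) tan (pi y).
  \<open>jensen_tan\<close> in y gives ln (1 + s^2 + 2 |s sin|), whose mean over z is
  \<open>ln_sin_mean\<close>.\<close>

lemma mahler_identity_2:
  fixes v :: real
  assumes "v > 0"
  shows "mahler3 (\<lambda>x y z. 1 - of_real v ^ 4 * ((1 - x) / (1 + x)) ^ 2
          + of_real v ^ 2 * ((1 - x) / (1 + x)) * ((1 - y) / (1 + y)) * (z - inverse z))
     = 8 / pi * (LBINT u:{0..v}. arctan u / u) - 16 / pi ^ 2 * T_arctan v (1 / v)"
proof -
  define s where "s x = v\<^sup>2 * tan (pi * x)" for x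
  define H where "H x = 4 / pi * ti2 (v\<^sup>2 * \<bar>tan (pi * x)\<bar>)" for x
  define G where "G x z = ln (1 + (s x)\<^sup>2 + \<bar>2 * s x * sin (2 * pi * z)\<bar>)" for x z
  define F where "F x z y = ln (cmod (Complex (1 + (s x)\<^sup>2) (- 2 * s x * sin (2 * pi * z) * tan (pi * y))))" for x z y
  have F0: "0 \<le> F x z y" for x z y
  proof -
    have "1 \<le> \<bar>Re (Complex (1 + (s x)\<^sup>2) b)\<bar>" for b by simp
    then show ?thesis unfolding F_def by (intro ln_ge_zero) (meson abs_Re_le_cmod order_trans)
  qed
  have iH: "integrable unit_measure H"
    unfolding H_def by (rule integrable_mult_ti2_tan) simp
  have "mahler3 (\<lambda>x y z. 1 - of_real v ^ 4 * ((1 - x) / (1 + x)) ^ 2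
          + of_real v ^ 2 * ((1 - x) / (1 + x)) * ((1 - y) / (1 + y)) * (z - inverse z)) = (LINT x|unit_measure. H x)"
  proof (rule mahler3_iterated)
    show "ln (cmod (1 - of_real v ^ 4 * ((1 - unit_circle (\<theta> 0)) / (1 + unit_circle (\<theta> 0))) ^ 2
          + of_real v ^ 2 * ((1 - unit_circle (\<theta> 0)) / (1 + unit_circle (\<theta> 0))) *
            ((1 - unit_circle (\<theta> 1)) / (1 + unit_circle (\<theta> 1))) * (unit_circle (\<theta> 2) - inverse (unit_circle (\<theta> 2)))))
        = F (\<theta> 0) (\<theta> 2) (\<theta> 1)" for \<theta>
      unfolding unit_circle_cayley unit_circle_minus_inverse F_def s_def
      by (rule arg_cong[where f = "\<lambda>w. ln (cmod w)"])
         (simp add: complex_eq_iff power2_eq_square power_numeral_reduce)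
    \<comment> \<open>The factor tan (pi y) rules out an upper bound in x alone. The modulus is at
      least 1, however, so \<open>- F\<close> is bounded above by 0, and the result is transferred
      by negation.\<close>
    have "(LINT \<theta>|torus {..<3}. - F (\<theta> 0) (\<theta> 2) (\<theta> 1)) = (LINT x|unit_measure. - H x)"
    proof (rule torus3_iterated[where F = "\<lambda>x z y. - F x z y" and A = "\<lambda>_. True" and B = "\<lambda>_. True" and G = "\<lambda>x z. - G x z" and g = "\<lambda>_. 0"])
      show "(\<lambda>(x, z, y). - F x z y) \<in> borel_measurable (borel \<Otimes>\<^sub>M borel \<Otimes>\<^sub>M borel)"
        unfolding F_def cmod_def complex.sel s_def tan_def by measurable
      show "(\<lambda>(x, z). - G x z) \<in> borel_measurable (borel \<Otimes>\<^sub>M borel)"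
        unfolding G_def s_def tan_def by measurable
      fix x z
      have A: "0 < 1 + (s x)\<^sup>2" by (intro add_pos_nonneg) auto
      have "integrable unit_measure (F x z)" "(LINT y|unit_measure. F x z y) = G x z"
        using jensen_tan[OF A, of 1 "- 2 * s x * sin (2 * pi * z)"] unfolding F_def G_def by simp_all
      then show "integrable unit_measure (\<lambda>y. - F x z y) \<and> (LINT y|unit_measure. - F x z y) = - G x z"
        by simp
      have e: "G x = (\<lambda>z. ln (1 + (v\<^sup>2 * \<bar>tan (pi * x)\<bar>)\<^sup>2 + 2 * (v\<^sup>2 * \<bar>tan (pi * x)\<bar>) * \<bar>sin (2 * pi * z)\<bar>))"
        unfolding G_def s_def by (simp add: abs_mult power_mult_distrib)
      have "integrable unit_measure (G x)" "(LINT z|unit_measure. G x z) = H x"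
        unfolding e H_def by (rule ln_sin_mean; simp)+
      then show "integrable unit_measure (\<lambda>z. - G x z) \<and> (LINT z|unit_measure. - G x z) = - H x"
        by simp
    qed (use lessThan_3 iH F0 in auto)
    then show "(LINT \<theta>|torus {..<3}. F (\<theta> 0) (\<theta> 2) (\<theta> 1)) = (LINT x|unit_measure. H x)"
      by simp
  qed
  also have "\<dots> = 2 * (2 / pi * (LINT x|unit_measure. ti2 (v\<^sup>2 * \<bar>tan (pi * x)\<bar>)))"
    unfolding H_def by simp
  finally show ?thesis
    unfolding ti2_tan_mean[OF assms] ti2_def[symmetric] ti2_mean_rearrange by simp
qed

text \<open>The polynomial becomes 2 (s sin (2 pi z) + i sin (2 pi y)). With s sin (2 pi z) = sinh
  w, \<open>jensen_sinh\<close> in y gives |w|, the term - ln 2 cancelling the factor 2, and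
  \<open>arsinh_sin_mean\<close> finishes over z.\<close>

lemma mahler_identity_3:
  fixes v :: real
  assumes "v > 0"
  shows "mahler3 (\<lambda>x y z. (y - inverse y) + of_real v ^ 2 * ((1 - x) / (1 + x)) * (z - inverse z))
     = 4 / pi * (LBINT u:{0..v}. arctan u / u) - 8 / pi ^ 2 * T_arctan v (1 / v)"
proof -
  define s where "s x = v\<^sup>2 * tan (pi * x)" for x
  define H where "H x = 2 / pi * ti2 (v\<^sup>2 * \<bar>tan (pi * x)\<bar>)" for x
  define G where "G x z = \<bar>arsinh (s x * sin (2 * pi * z))\<bar>" for x z
  define F where "F x z y = ln (cmod (Complex (2 * (s x * sin (2 * pi * z))) (2 * sin (2 * pi * y))))" for x z y
  have iH: "integrable unit_measure H"
    unfolding H_def by (rule integrable_mult_ti2_tan) simp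
  have "mahler3 (\<lambda>x y z. (y - inverse y) + of_real v ^ 2 * ((1 - x) / (1 + x)) * (z - inverse z)) = (LINT x|unit_measure. H x)"
  proof (rule mahler3_iterated)
    show "ln (cmod ((unit_circle (\<theta> 1) - inverse (unit_circle (\<theta> 1)))
          + of_real v ^ 2 * ((1 - unit_circle (\<theta> 0)) / (1 + unit_circle (\<theta> 0))) * (unit_circle (\<theta> 2) - inverse (unit_circle (\<theta> 2)))))
        = F (\<theta> 0) (\<theta> 2) (\<theta> 1)" for \<theta>
      unfolding unit_circle_cayley unit_circle_minus_inverse F_def s_def
      by (rule arg_cong[where f = "\<lambda>w. ln (cmod w)"])
         (simp add: complex_eq_iff power2_eq_square)
    show "(LINT \<theta>|torus {..<3}. F (\<theta> 0) (\<theta> 2) (\<theta> 1)) = (LINT x|unit_measure. H x)"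
    proof (rule torus3_iterated[where A = "\<lambda>x. tan (pi * x) \<noteq> 0" and B = "\<lambda>z. sin (2 * pi * z) \<noteq> 0" and G = G])
      show "(\<lambda>(x, z, y). F x z y) \<in> borel_measurable (borel \<Otimes>\<^sub>M borel \<Otimes>\<^sub>M borel)"
        unfolding F_def cmod_def complex.sel s_def tan_def by measurable
      have "(arsinh :: real \<Rightarrow> real) \<in> borel_measurable borel"
        by (intro borel_measurable_continuous_onI continuous_intros)
      then show "(\<lambda>(x, z). G x z) \<in> borel_measurable (borel \<Otimes>\<^sub>M borel)"
        unfolding G_def s_def tan_def by measurable
      show "integrable unit_measure (\<lambda>x. ln 36 + 4 * ln (1 + v\<^sup>2 * \<bar>tan (pi * x)\<bar>))"
        by (rule integrable_weight) simp
      show "integrable unit_measure H" by (rule iH)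
      fix x z
      define r where "r = v\<^sup>2 * \<bar>tan (pi * x)\<bar>"
      have r: "r = \<bar>s x\<bar>" "0 \<le> r" by (auto simp: r_def s_def abs_mult)
      show "F x z y \<le> ln 36 + 4 * ln (1 + v\<^sup>2 * \<bar>tan (pi * x)\<bar>)" for y
        unfolding F_def r_def[symmetric]
      proof (rule ln_le_weight)
        have "\<bar>2 * (s x * sin (2 * pi * z))\<bar> \<le> 2 * r" "\<bar>2 * sin (2 * pi * y)\<bar> \<le> 2"
          using r by (auto simp: abs_mult intro: mult_left_le)
        then have "cmod (Complex (2 * (s x * sin (2 * pi * z))) (2 * sin (2 * pi * y))) \<le> 2 * r + 2"
          using cmod_le[of "Complex (2 * (s x * sin (2 * pi * z))) (2 * sin (2 * pi * y))"] by simp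
        also have "\<dots> \<le> 36 * (1 + r) ^ 4"
          using r(2) by (simp add: power_numeral_reduce algebra_simps)
        finally show "cmod (Complex (2 * (s x * sin (2 * pi * z))) (2 * sin (2 * pi * y))) \<le> 36 * (1 + r) ^ 4" .
      qed (use r in auto)
      show "integrable unit_measure (F x z) \<and> (LINT y|unit_measure. F x z y) = G x z"
        if "tan (pi * x) \<noteq> 0" "sin (2 * pi * z) \<noteq> 0"
      proof -
        define w where "w = arsinh (s x * sin (2 * pi * z))"
        have w: "sinh w = s x * sin (2 * pi * z)" by (simp add: w_def)
        then have nz: "sinh w \<noteq> 0" using that assms by (simp add: s_def)
        then have w0: "w \<noteq> 0" by auto
        have "F x z y = ln 2 + ln (cmod (Complex (sinh w) (sin (2 * pi * y))))" for y
        proof -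
          have "Complex (2 * (s x * sin (2 * pi * z))) (2 * sin (2 * pi * y)) = 2 * Complex (sinh w) (sin (2 * pi * y))"
            by (simp add: complex_eq_iff w)
          moreover have "cmod (Complex (sinh w) (sin (2 * pi * y))) > 0"
            using nz by (simp add: complex_eq_iff)
          ultimately show ?thesis unfolding F_def by (simp add: norm_mult ln_mult_pos)
        qed
        then have "F x z = (\<lambda>y. ln 2 + ln (cmod (Complex (sinh w) (sin (2 * pi * y)))))" by auto
        then show ?thesis
          using jensen_sinh[OF w0] by (simp add: G_def w_def[symmetric] unit.prob_space[simplified])
      qed
      have "G x = (\<lambda>z. arsinh (r * \<bar>sin (2 * pi * z)\<bar>))"
      proof
        fix z
        have "\<bar>arsinh t\<bar> = arsinh \<bar>t\<bar>" for t :: real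
          by (cases "t \<ge> 0") (simp_all add: abs_if arsinh_minus_real)
        then show "G x z = arsinh (r * \<bar>sin (2 * pi * z)\<bar>)"
          unfolding G_def r(1) by (simp add: abs_mult)
      qed
      then show "integrable unit_measure (G x) \<and> (LINT z|unit_measure. G x z) = H x"
        using arsinh_sin_mean[OF r(2)] by (simp add: H_def r_def)
    qed (use lessThan_3 AE_tan_nonzero[of pi] AE_sin_nonzero[of "2 * pi"] in auto)
  qed
  also have "\<dots> = 2 / pi * (LINT x|unit_measure. ti2 (v\<^sup>2 * \<bar>tan (pi * x)\<bar>))"
    unfolding H_def by simp
  finally show ?thesis
    unfolding ti2_tan_mean[OF assms] ti2_def[symmetric] ti2_mean_rearrange .
qed

text \<open>The squared Cayley term is - tan^2, so x enters through 1 + s^2 and 1 - s^2, and s may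
  be taken nonnegative. The polynomial is then a difference of squares, 4 ((1 + y)^2 D^2 - C^2),
  hence a product of two linear factors in y. As 0 \<le> C \<le> D, Jensen selects D from the factor
  with D - C and D + C from the other.\<close>

lemma mahler_identity_4:
  fixes v :: real
  assumes "v > 0"
  shows "mahler3 (\<lambda>x y z. (4 * (1 + y) ^ 2 - (z + inverse z) ^ 2)
            * (1 - of_real v ^ 4 * ((1 - x) / (1 + x)) ^ 2) ^ 2
          + (z - inverse z) ^ 2 * (1 + y) ^ 2
            * (1 + of_real v ^ 4 * ((1 - x) / (1 + x)) ^ 2) ^ 2)
     = 8 / pi * (LBINT u:{0..v}. arctan u / u) - 16 / pi ^ 2 * T_arctan v (1 / v)
       + 4 / pi * (LBINT \<theta>:{0..pi / 2}. ln (1 + v ^ 2 * tan \<theta>)) + ln 2"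
proof -
  define s where "s x = v\<^sup>2 * \<bar>tan (pi * x)\<bar>" for x
  define C where "C x z = (1 + (s x)\<^sup>2) * \<bar>cos (2 * pi * z)\<bar>" for x z
  define D where "D x z = cmod (Complex ((1 + (s x)\<^sup>2) * cos (2 * pi * z)) (2 * s x * sin (2 * pi * z)))" for x z
  define H where "H x = 4 / pi * ti2 (s x) + 2 * ln (1 + s x) + ln 2" for x
  define G where "G x z = ln 4 + ln (D x z) + ln (D x z + C x z)" for x z
  define Q where "Q x z y = 4 * ((of_real (D x z - C x z) + of_real (D x z) * unit_circle y) *
     (of_real (D x z + C x z) + of_real (D x z) * unit_circle y))" for x z y
  define F where "F x z y = ln (cmod (Q x z y))" for x z y
  have s0: "0 \<le> s x" for x by (simp add: s_def)
  have D2: "(D x z)\<^sup>2 = (1 + (s x)\<^sup>2)\<^sup>2 - (sin (2 * pi * z))\<^sup>2 * (1 - (s x)\<^sup>2)\<^sup>2" for x z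
    unfolding D_def cmod_power2 complex.sel using sin_cos_squared_add[of "2 * pi * z"] by algebra
  have D2C: "(D x z)\<^sup>2 = (C x z)\<^sup>2 + (2 * s x * sin (2 * pi * z))\<^sup>2" for x z
    unfolding D_def C_def cmod_power2 complex.sel by (simp add: power_mult_distrib)
  have C2: "(C x z)\<^sup>2 = (1 + (s x)\<^sup>2)\<^sup>2 * (cos (2 * pi * z))\<^sup>2" for x z
    unfolding C_def by (simp add: power_mult_distrib)
  have D0: "0 \<le> D x z" and C0: "0 \<le> C x z" for x z
    by (simp_all add: D_def C_def)
  have CD: "C x z \<le> D x z" for x z
    by (rule power2_le_imp_le) (use D2C[of x z] D0 in auto)
  have DA: "D x z \<le> 1 + (s x)\<^sup>2" for x z
    by (rule power2_le_imp_le) (use D2[of x z] in auto)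
  have q: "of_real v ^ 4 * ((1 - unit_circle x) / (1 + unit_circle x)) ^ 2 = - of_real ((s x)\<^sup>2)" for x
    unfolding unit_circle_cayley s_def by (simp add: complex_eq_iff power2_eq_square power_numeral_reduce)
  have Qeq: "(4 * (1 + unit_circle y) ^ 2 - (unit_circle z + inverse (unit_circle z)) ^ 2) * (1 - - of_real ((s x)\<^sup>2)) ^ 2
     + (unit_circle z - inverse (unit_circle z)) ^ 2 * (1 + unit_circle y) ^ 2 * (1 + - of_real ((s x)\<^sup>2)) ^ 2 = Q x z y" for x y z
  proof -
    define u where "u = 1 + unit_circle y"
    have 1: "Complex 0 (2 * sin (2 * pi * z)) = \<i> * of_real (2 * sin (2 * pi * z))" by (simp add: complex_eq_iff)
    have 2: "(1 - - of_real ((s x)\<^sup>2)) = complex_of_real (1 + (s x)\<^sup>2)" "(1 + - of_real ((s x)\<^sup>2)) = complex_of_real (1 - (s x)\<^sup>2)"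
      by simp_all
    have "Q x z y = 4 * (u\<^sup>2 * of_real ((D x z)\<^sup>2) - of_real ((C x z)\<^sup>2))"
      unfolding Q_def u_def by (simp add: power2_eq_square algebra_simps)
    also have "\<dots> = (4 * u ^ 2 - of_real (2 * cos (2 * pi * z)) ^ 2) * complex_of_real (1 + (s x)\<^sup>2) ^ 2
      + (\<i> * of_real (2 * sin (2 * pi * z))) ^ 2 * u ^ 2 * complex_of_real (1 - (s x)\<^sup>2) ^ 2"
      unfolding D2 C2 power_mult_distrib i_squared
      by (simp add: algebra_simps)
    finally show ?thesis
      unfolding unit_circle_plus_inverse unit_circle_minus_inverse 1 2 u_def by simp
  qed
  have iH1: "integrable unit_measure (\<lambda>x. 4 / pi * ti2 (s x))"
    unfolding s_def by (rule integrable_mult_ti2_tan) simp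
  have iH2: "integrable unit_measure (\<lambda>x. ln (1 + s x))"
    unfolding s_def using integrable_ln_tan[of "v\<^sup>2" 1] by simp
  have "mahler3 (\<lambda>x y z. (4 * (1 + y) ^ 2 - (z + inverse z) ^ 2)
            * (1 - of_real v ^ 4 * ((1 - x) / (1 + x)) ^ 2) ^ 2
          + (z - inverse z) ^ 2 * (1 + y) ^ 2
            * (1 + of_real v ^ 4 * ((1 - x) / (1 + x)) ^ 2) ^ 2) = (LINT x|unit_measure. H x)"
  proof (rule mahler3_iterated)
    show "ln (cmod ((4 * (1 + unit_circle (\<theta> 1)) ^ 2 - (unit_circle (\<theta> 2) + inverse (unit_circle (\<theta> 2))) ^ 2)
            * (1 - of_real v ^ 4 * ((1 - unit_circle (\<theta> 0)) / (1 + unit_circle (\<theta> 0))) ^ 2) ^ 2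
          + (unit_circle (\<theta> 2) - inverse (unit_circle (\<theta> 2))) ^ 2 * (1 + unit_circle (\<theta> 1)) ^ 2
            * (1 + of_real v ^ 4 * ((1 - unit_circle (\<theta> 0)) / (1 + unit_circle (\<theta> 0))) ^ 2) ^ 2))
      = F (\<theta> 0) (\<theta> 2) (\<theta> 1)" for \<theta>
      unfolding q Qeq F_def ..
    show "(LINT \<theta>|torus {..<3}. F (\<theta> 0) (\<theta> 2) (\<theta> 1)) = (LINT x|unit_measure. H x)"
    proof (rule torus3_iterated[where A = "\<lambda>x. tan (pi * x) \<noteq> 0" and G = G
          and B = "\<lambda>z. sin (2 * pi * z) \<noteq> 0 \<and> cos (2 * pi * z) \<noteq> 0"])
      show "(\<lambda>(x, z, y). F x z y) \<in> borel_measurable (borel \<Otimes>\<^sub>M borel \<Otimes>\<^sub>M borel)"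
        unfolding F_def Q_def unfolding D_def C_def cmod_def[of "Complex _ _"] complex.sel unfolding s_def tan_def
        by measurable
      show "(\<lambda>(x, z). G x z) \<in> borel_measurable (borel \<Otimes>\<^sub>M borel)"
        unfolding G_def D_def C_def cmod_def complex.sel s_def tan_def by measurable
      show "integrable unit_measure (\<lambda>x. ln 36 + 4 * ln (1 + v\<^sup>2 * \<bar>tan (pi * x)\<bar>))"
        by (rule integrable_weight) simp
      show "integrable unit_measure H"
        unfolding H_def using iH1 iH2 by simp
      fix x z
      show "F x z y \<le> ln 36 + 4 * ln (1 + v\<^sup>2 * \<bar>tan (pi * x)\<bar>)" for y
        unfolding F_def s_def[symmetric]
      proof (rule ln_le_weight)
        define a where "a = 1 + (s x)\<^sup>2"
        have b: "D x z \<le> a" "C x z \<le> a" "D x z - C x z \<le> a" "0 \<le> a" "0 \<le> D x z - C x z"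
          using CD[of x z] DA[of x z] C0[of x z] by (auto simp: a_def)
        have u: "cmod (of_real p + of_real (D x z) * unit_circle y) \<le> p + D x z" if "0 \<le> p" for p
          using norm_triangle_ineq[of "of_real p" "of_real (D x z) * unit_circle y"] that D0[of x z]
          by (simp add: norm_mult)
        have "cmod (Q x z y) \<le> 4 * ((D x z - C x z + D x z) * (D x z + C x z + D x z))"
          unfolding Q_def norm_mult using u[of "D x z - C x z"] u[of "D x z + C x z"] b D0[of x z] C0[of x z]
          by (auto intro!: mult_mono)
        also have "\<dots> \<le> 4 * ((2 * a) * (3 * a))"
          using b D0[of x z] C0[of x z] by (intro mult_left_mono mult_mono) auto
        also have "\<dots> \<le> 36 * (1 + s x) ^ 4"
          using s0[of x] unfolding a_def by (simp add: power_numeral_reduce algebra_simps)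
        finally show "cmod (Q x z y) \<le> 36 * (1 + s x) ^ 4" .
      qed (use s0 in auto)
      assume A: "tan (pi * x) \<noteq> 0"
      then have s: "0 < s x" using assms by (simp add: s_def)
      show "integrable unit_measure (F x z) \<and> (LINT y|unit_measure. F x z y) = G x z"
        if nz: "sin (2 * pi * z) \<noteq> 0 \<and> cos (2 * pi * z) \<noteq> 0"
      proof -
        have Cp: "0 < C x z" unfolding C_def using nz by (intro mult_pos_pos add_pos_nonneg) auto
        have CDs: "C x z < D x z"
          by (rule power2_less_imp_less) (use D2C[of x z] D0 nz s in auto)
        let ?a = "complex_of_real (D x z - C x z)" and ?b = "complex_of_real (D x z + C x z)" and ?d = "complex_of_real (D x z)"
        have n: "cmod ?a = D x z - C x z" "cmod ?b = D x z + C x z" "cmod ?d = D x z"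
          unfolding norm_of_real using Cp CDs by auto
        have nz': "c + ?d * unit_circle y \<noteq> 0" if "cmod c \<noteq> cmod ?d" for c y
        proof
          assume "c + ?d * unit_circle y = 0"
          then have "c = - (?d * unit_circle y)" by (simp add: add_eq_0_iff2)
          then show False using that by (simp add: norm_mult)
        qed
        have ne: "cmod ?a \<noteq> cmod ?d" "cmod ?b \<noteq> cmod ?d" unfolding n using Cp by auto
        have Fe: "F x z y = ln 4 + ln (cmod (?a + ?d * unit_circle y ^ 1)) + ln (cmod (?b + ?d * unit_circle y ^ 1))" for y
        proof -
          have "0 < cmod (?a + ?d * unit_circle y)" "0 < cmod (?b + ?d * unit_circle y)"
            using nz'[OF ne(1)] nz'[OF ne(2)] by auto
          then show ?thesis unfolding F_def Q_def norm_mult power_one_right by (simp add: ln_mult_pos)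
        qed
        have m: "max (cmod ?a) (cmod ?d) = D x z" "max (cmod ?b) (cmod ?d) = D x z + C x z"
          unfolding n using Cp by auto
        show ?thesis
          using jensen_linear[OF ne(1) zero_less_one] jensen_linear[OF ne(2) zero_less_one]
          unfolding Fe[abs_def] G_def m by (simp add: unit.prob_space[simplified] del: power_one_right)
      qed
      have "2 * s x > 0" "1 + (s x)\<^sup>2 > 0" using s by (auto intro: add_pos_nonneg)
      \<comment> \<open>D is the modulus on an ellipse with semi-axes 1 + s^2 and 2 s, whose sum (1
        + s)^2 produces the term 2 ln (1 + s).\<close>
      then have e1: "integrable unit_measure (\<lambda>z. ln (D x z))"
        "(LINT z|unit_measure. ln (D x z)) = ln ((1 + (s x)\<^sup>2 + 2 * s x) / 2)"
        using jensen_ellipse[of "1 + (s x)\<^sup>2" "2 * s x" 2] by (simp_all add: D_def)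
      have e2: "integrable unit_measure (\<lambda>z. ln (D x z + C x z))"
        "(LINT z|unit_measure. ln (D x z + C x z)) = 4 / pi * ti2 (s x)"
        using ln_ellipse_sum_mean[OF s] by (simp_all add: D_def C_def)
      have "ln 4 + ln ((1 + (s x)\<^sup>2 + 2 * s x) / 2) = 2 * ln (1 + s x) + ln 2"
      proof -
        have "ln 4 + ln ((1 + (s x)\<^sup>2 + 2 * s x) / 2) = ln (4 * ((1 + (s x)\<^sup>2 + 2 * s x) / 2))"
          using s by (intro ln_mult_pos[symmetric]) (auto intro!: add_pos_pos add_pos_nonneg)
        also have "4 * ((1 + (s x)\<^sup>2 + 2 * s x) / 2) = (1 + s x)\<^sup>2 * 2"
          by (simp add: power2_eq_square algebra_simps)
        also have "ln ((1 + s x)\<^sup>2 * 2) = ln ((1 + s x)\<^sup>2) + ln 2"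
          using s by (intro ln_mult_pos) auto
        also have "ln ((1 + s x)\<^sup>2) = 2 * ln (1 + s x)"
          using s by (simp add: ln_realpow)
        finally show ?thesis .
      qed
      then show "integrable unit_measure (G x) \<and> (LINT z|unit_measure. G x z) = H x"
        unfolding G_def[abs_def] H_def using e1 e2 by (simp add: unit.prob_space[simplified])
    qed (use lessThan_3 AE_tan_nonzero[of pi] AE_sin_nonzero[of "2 * pi"] AE_cos_nonzero[of "2 * pi"] in auto)
  qed
  also have "\<dots> = 2 * (2 / pi * (LINT x|unit_measure. ti2 (v\<^sup>2 * \<bar>tan (pi * x)\<bar>))) + 2 * (LINT x|unit_measure. ln (1 + s x)) + ln 2"
    unfolding H_def using iH1 iH2 by (simp add: s_def unit.prob_space[simplified])
  also have "(LINT x|unit_measure. ln (1 + s x)) = 2 / pi * (LBINT \<theta>:{0..pi / 2}. ln (1 + v\<^sup>2 * tan \<theta>))"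
    unfolding s_def by (rule unit_measure_tan[where f = "\<lambda>t. ln (1 + v\<^sup>2 * t)"]) (use iH2 s_def in simp)
  finally show ?thesis
    unfolding ti2_tan_mean[OF assms] ti2_def[symmetric] ti2_mean_rearrange by simp
qed

theorem theorem7p3:
  fixes v :: real
  assumes "v > 0"
  shows
    "(mahler3 (\<lambda>x y z. 1 - of_real v ^ 4 * ((1 - x) / (1 + x)) ^ 2
          + (y + of_real v ^ 2 * ((1 - x) / (1 + x))) ^ 2 * z)
     = 4 / pi * (LBINT u:{0..v}. arctan u / u) - 8 / pi ^ 2 * T_arctan v (1 / v)
       + 1 / 2 * mahler1 (\<lambda>x. 1 - of_real v ^ 4 * ((1 - x) / (1 + x)) ^ 2)) \<and>
     (mahler3 (\<lambda>x y z. 1 - of_real v ^ 4 * ((1 - x) / (1 + x)) ^ 2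
          + of_real v ^ 2 * ((1 - x) / (1 + x)) * ((1 - y) / (1 + y)) * (z - inverse z))
     = 8 / pi * (LBINT u:{0..v}. arctan u / u) - 16 / pi ^ 2 * T_arctan v (1 / v)) \<and>
     (mahler3 (\<lambda>x y z. (y - inverse y)
          + of_real v ^ 2 * ((1 - x) / (1 + x)) * (z - inverse z))
     = 4 / pi * (LBINT u:{0..v}. arctan u / u) - 8 / pi ^ 2 * T_arctan v (1 / v)) \<and>
     (mahler3 (\<lambda>x y z. (4 * (1 + y) ^ 2 - (z + inverse z) ^ 2)
            * (1 - of_real v ^ 4 * ((1 - x) / (1 + x)) ^ 2) ^ 2
          + (z - inverse z) ^ 2 * (1 + y) ^ 2
            * (1 + of_real v ^ 4 * ((1 - x) / (1 + x)) ^ 2) ^ 2)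
     = 8 / pi * (LBINT u:{0..v}. arctan u / u) - 16 / pi ^ 2 * T_arctan v (1 / v)
       + 4 / pi * (LBINT \<theta>:{0..pi / 2}. ln (1 + v ^ 2 * tan \<theta>)) + ln 2)"
  using mahler_identity_1[OF assms] mahler_identity_2[OF assms]
    mahler_identity_3[OF assms] mahler_identity_4[OF assms] by blast

end
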